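(* For $n$ players and $2$ transmission channels with ternary feedback, there exists a unique anonymous, history-independent equilibrium protocol, and it has the following form: when $m$ players are pending, $2\le m\le n$, every pending player in every slot $t\ge1$ attempts transmission on each of the two channels with the same probability $p_m$. Moreover $p_m=\Theta(1/\sqrt{m})$, and this protocol yields to every player expected future latency $e^{\Theta(\sqrt{m})}$ when $m$ players are pending.
   Context: Contention game: $n$ players, channel set $K=\{1,\dots,k\}$ (here $k=2$), discrete slots $t=1,2,\dots$; each player has one packet and is initially pending. In each slot a pending player chooses (possibly at random) an action in $\{0,1,\dots,k\}$ ($0$ = no transmission, $a$ = transmit on channel $a$). A lone transmitter on a channel succeeds and leaves; two or more transmitters on a channel collide and remain pending. Latency $T_i$ = slot of player $i$'s successful transmission; players minimize expected latency. Expected future latency at slot $t$ = conditional expected latency minus $t$. Ternary feedback: in every slot every pending player is informed of the current number $m$ of pending players. A history-independent protocol is one whose decision rules depend only on the number $m$ of pending players (not on the player's transmission history or on time). Anonymous: all players use the same protocol, independent of identity. Equilibrium protocol: when all players use it, no player at any slot and after any history can decrease her conditional expected latency by unilaterally deviating. *)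

theory Defs
  imports "HOL-Probability.Probability" "HOL-Library.Landau_Symbols"
begin

text \<open>Contention game with k = 2 channels. Actions: 0 = silent, 1, 2 = transmit on channel 1, 2.
A history-independent anonymous protocol: number m of pending players to a distribution on actions.\<close>

type_synonym protocol = "nat \<Rightarrow> nat pmf"

text \<open>A general (history-dependent) deviation strategy of a single player: given her past
observations (pairs (pending count, own action), most recent first) and the current pending
count m, a distribution on actions.\<close>

type_synonym strategy = "(nat \<times> nat) list \<Rightarrow> nat \<Rightarrow> nat pmf"

definition others :: "protocol \<Rightarrow> nat \<Rightarrow> (nat \<Rightarrow> nat) pmf" where
  "others P m = Pi_pmf {..<m - 1} 0 (\<lambda>_. P m)"

definition chan_success :: "nat \<Rightarrow> (nat \<Rightarrow> nat) \<Rightarrow> nat \<Rightarrow> nat \<Rightarrow> bool" where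
  "chan_success m f a c \<longleftrightarrow> card {j. j < m - 1 \<and> f j = c} + (if a = c then 1 else 0) = 1"

definition dev_success :: "nat \<Rightarrow> (nat \<Rightarrow> nat) \<Rightarrow> nat \<Rightarrow> bool" where
  "dev_success m f a \<longleftrightarrow> a \<in> {1, 2} \<and> chan_success m f a a"

definition next_pending :: "nat \<Rightarrow> (nat \<Rightarrow> nat) \<Rightarrow> nat \<Rightarrow> nat" where
  "next_pending m f a = m - card {c \<in> {1, 2}. chan_success m f a c}"

fun pend :: "protocol \<Rightarrow> strategy \<Rightarrow> nat \<Rightarrow> (nat \<times> nat) list \<Rightarrow> nat \<Rightarrow> ennreal" where
  "pend P S 0 h m = 1"
| "pend P S (Suc s) h m =
     (\<integral>\<^sup>+ a. (\<integral>\<^sup>+ f. (if dev_success m f a then 0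
                        else pend P S s ((m, a) # h) (next_pending m f a))
              \<partial>measure_pmf (others P m))
      \<partial>measure_pmf (S h m))"

text \<open>Expected number of slots until success, counting the current slot as 1
(i.e. E[T] - t + 1 when pending at slot t), as sum of tail probabilities.\<close>

definition exp_latency :: "protocol \<Rightarrow> strategy \<Rightarrow> nat \<Rightarrow> ennreal" where
  "exp_latency P S m = (\<Sum>s. pend P S s [] m)"

definition follow :: "protocol \<Rightarrow> strategy" where
  "follow P = (\<lambda>h m. P m)"

text \<open>Expected future latency (E[T | pending at slot t, m pending] - t) under the protocol.\<close>

definition future_latency :: "protocol \<Rightarrow> nat \<Rightarrow> ennreal" where
  "future_latency P m = exp_latency P (follow P) m - 1"

definition valid_strategy :: "strategy \<Rightarrow> bool" where
  "valid_strategy S \<longleftrightarrow> (\<forall>h m. set_pmf (S h m) \<subseteq> {0, 1, 2})"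

text \<open>Equilibrium for n players: in every reachable situation (m pending, 1 \<le> m \<le> n, arbitrary
past history, absorbed into the deviation strategy) no unilateral deviation lowers the
conditional expected latency.\<close>

definition equilibrium :: "nat \<Rightarrow> protocol \<Rightarrow> bool" where
  "equilibrium n P \<longleftrightarrow>
     (\<forall>m \<in> {1..n}. set_pmf (P m) \<subseteq> {0, 1, 2}) \<and>
     (\<forall>S. valid_strategy S \<longrightarrow>
        (\<forall>m \<in> {1..n}. exp_latency P (follow P) m \<le> exp_latency P S m))"

end

theory Submission
  imports Defs
begin

text \<open>
  Write \<open>N = m - 1\<close> for the number of opponents, \<open>x\<close> and \<open>y\<close> for their transmission
  probabilities, and \<open>v, b, c\<close> for the expected latencies with \<open>m\<close>, \<open>m - 1\<close> and \<open>m - 2\<close>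
  pending players.  Optimality is a one-slot condition: each action saves at most one expected
  slot compared with waiting at value \<open>v\<close>, and exactly one on the support.  Comparing the two
  channels with silence forces \<open>x = y\<close>.  In terms of the odds \<open>t = x / (1 - x)\<close> the remaining
  equations become polynomial; eliminating \<open>v\<close> leaves an increasing function of \<open>t\<close> equated to a
  nonincreasing one, whence uniqueness, while the intermediate value theorem gives existence
  (\<open>t = 1\<close>, no silence, for at most four players).
  With \<open>a = N t\<close> the equations say \<open>v - b\<close> is of order \<open>(1 + t)^N / a\<close> and \<open>b\<close> of order
  \<open>(1 + t)^N\<close>, so \<open>a\<close> is of order \<open>ln b\<close> and \<open>(ln v)^2\<close> increases by a bounded amount, bounded
  away from zero, with every additional player.
\<close>

section \<open>Polynomial inequalities\<close>

text \<open>The number of pending players never increases, so the value with \<open>m\<close>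
  pending depends only on itself and on smaller counts: it is built upwards in \<open>m\<close>, and
  the same values serve every \<open>n\<close>. The obstacle is that the elimination is controlled
  only for suitable \<open>b\<close> and \<open>c\<close>, and each step must reproduce this
  control; that is the role of \<open>admissible\<close>. Its clause
  \<open>3 * (b - c) \<le> 2 * b\<close> keeps \<open>(b - c) * both_coeff\<close> below
  \<open>b / 2\<close>, and \<open>b \<le> 2^(N-1)\<close> handles play without silence. Odds are
  convenient because \<open>1 - x = 1 / (1 + t)\<close> and
  \<open>1 - 2 * x = (1 - t) / (1 + t)\<close>, so that all probabilities share the denominator
  \<open>(1 + t)^N\<close>. Two points on the side of the game are not visible in the equations. An
  equilibrium latency might be infinite; a deviation that insists on a channel used with probability
  at most 1/2 excludes this. Deviations may depend on the whole history; super- and subsolutions of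
  the Bellman equation deal with all of them at once.\<close>

lemma binomial_ge_twice_linear_term:
  fixes r s :: real
  assumes "0 \<le> r" "0 \<le> s" "2 \<le> n"
  shows "2 * real n * s * r ^ (n - 1) \<le> (r + s) ^ n"
proof -
  have *: "r^(k+2) + real (k+2) * s * r^(k+1) + real (k+2) * real (k+1) / 2 * s^2 * r^k \<le> (r+s)^(k+2)" for k
  proof (induction k)
    case 0 then show ?case by (simp add: power2_eq_square algebra_simps)
  next
    case (Suc k)
    have "(r+s) * (r^(k+2) + real (k+2) * s * r^(k+1) + real (k+2) * real (k+1) / 2 * s^2 * r^k) \<le> (r+s)^(Suc k+2)"
      using mult_left_mono[OF Suc, of "r+s"] assms by simp
    moreover have "(r+s) * (r^(k+2) + real (k+2) * s * r^(k+1) + real (k+2) * real (k+1) / 2 * s^2 * r^k)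
      = r^(Suc k+2) + real (Suc k+2) * s * r^(Suc k+1) + real (Suc k+2) * real (Suc k+1) / 2 * s^2 * r^(Suc k)
        + real (k+2) * real (k+1) / 2 * s^3 * r^k"
      by (simp add: power2_eq_square power3_eq_cube field_simps)
    moreover have "0 \<le> real (k+2) * real (k+1) / 2 * s^3 * r^k" using assms by simp
    ultimately show ?case by linarith
  qed
  obtain k where k: "n = k + 2" using assms(3) by (metis add.commute le_Suc_ex)
  let ?z = "real n * s"
  \<comment> \<open>Only three binomial terms are kept. After subtracting twice the middle one they
    form \<open>r^k\<close> times a quadratic, which is a square plus a nonnegative rest because
    \<open>n \<ge> 2\<close>.\<close>
  have "r^(k+2) + real n * s * r^(k+1) + real n * real (k+1) / 2 * s^2 * r^k - 2 * real n * s * r^(k+1)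
     = r^k * (r^2 - real n * s * r + real n * real (k+1) / 2 * s^2)"
    by (simp add: algebra_simps power2_eq_square)
  moreover have "r^2 - real n * s * r + real n * real (k+1) / 2 * s^2
     = (r - real n * s / 2)^2 + real n * real k / 4 * s^2"
    by (simp add: k field_simps power2_eq_square)
  moreover have "0 \<le> r^k * ((r - real n * s / 2)^2 + real n * real k / 4 * s^2)"
    using assms by (intro mult_nonneg_nonneg add_nonneg_nonneg) auto
  ultimately show ?thesis using *[of k] by (simp add: k)
qed

text \<open>The left side is twice the probability of exactly two successes in \<open>n\<close>
  trials. The ratio of the polynomials for \<open>n + 1\<close> and \<open>n\<close> is at most 1
  precisely from \<open>t = 2 / (n + 1)\<close> on, and there the polynomial for
  \<open>n + 1\<close> has its maximum. So the maxima do not increase, and the value 3/4 at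
  \<open>n = 4\<close> bounds them all.\<close>

lemma square_times_power_le:
  fixes t :: real
  assumes "4 \<le> n" "0 \<le> t" "t \<le> 1"
  shows "real n * (real n - 1) * t^2 * (1 - t)^(n-2) \<le> 3/4"
  using assms
proof (induction n arbitrary: t rule: dec_induct)
  case base
  have "t * (1-t) \<le> 1/4" using zero_le_power2[of "t - 1/2"] by (simp add: power2_eq_square algebra_simps)
  then have "(t * (1-t))^2 \<le> (1/4)^2" using base by (intro power_mono) auto
  then show ?case by (simp add: power_mult_distrib power2_eq_square algebra_simps)
next
  case (step n)
  define f where "f = (\<lambda>k (t::real). real k * (real k - 1) * t^2 * (1 - t)^(k-2))"
  have rel: "f (Suc n) s = (real n + 1) / (real n - 1) * (1 - s) * f n s" for s
  proof -
    have "Suc n - 2 = Suc (n - 2)" using step.hyps by simp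
    then have p: "(1 - s)^(Suc n - 2) = (1 - s) * (1 - s)^(n - 2)" by (simp only: power_Suc)
    have "real n - 1 \<noteq> 0" using step.hyps by simp
    then have c: "real (Suc n) * (real (Suc n) - 1) = (real n + 1) / (real n - 1) * (real n * (real n - 1))"
      by (simp add: add.commute)
    show ?thesis unfolding f_def p c by (simp only: ac_simps)
  qed
  have fn: "0 \<le> f n s" if "0 \<le> s" "s \<le> 1" for s using that step.hyps unfolding f_def by simp
  define z where "z = 2 / (real n + 1)"
  have z: "0 \<le> z" "z \<le> 1" using step.hyps by (auto simp: z_def)
  have big: "f (Suc n) s \<le> 3/4" if "z \<le> s" "s \<le> 1" for s
  proof -
    have "(real n + 1) / (real n - 1) * (1 - s) \<le> 1"
      using that step.hyps by (simp add: z_def field_simps)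
    then have "(real n + 1) / (real n - 1) * (1 - s) * f n s \<le> 1 * f n s"
      using fn[of s] that z by (intro mult_right_mono) auto
    then have "f (Suc n) s \<le> f n s" unfolding rel by simp
    also have "\<dots> \<le> 3/4" unfolding f_def using step.IH[of s] that z by simp
    finally show ?thesis .
  qed
  have "f (Suc n) t \<le> f (Suc n) z" if "t \<le> z"
  proof -
    have "t^2 * (1-t)^(n-1) \<le> z^2 * (1-z)^(n-1)"
    proof (rule DERIV_nonneg_imp_nondecreasing[OF that])
      fix s assume s: "t \<le> s" "s \<le> z"
      have "((\<lambda>s. s^2 * (1-s)^(n-1)) has_real_derivative 2 * s * (1-s)^(n-1) - s^2 * (real (n-1) * (1-s)^(n-2))) (at s)"
        by (auto intro!: derivative_eq_intros simp: numeral_2_eq_2)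
      moreover have "2 * s * (1-s)^(n-1) - s^2 * (real (n-1) * (1-s)^(n-2))
         = s * (1-s)^(n-2) * (2 - (real n + 1) * s)"
      proof -
        have "n - 1 = Suc (n - 2)" using step.hyps by simp
        then have e1: "(1-s)^(n-1) = (1-s) * (1-s)^(n-2)" by simp
        have e2: "real (n - 1) = real n - 1" using step.hyps by (simp add: of_nat_diff)
        show ?thesis unfolding e1 e2 by (simp add: power2_eq_square algebra_simps)
      qed
      moreover have "s \<le> 1" "0 \<le> s" using s z step.prems by auto
      then have "0 \<le> s * (1-s)^(n-2) * (2 - (real n + 1) * s)"
        using s by (intro mult_nonneg_nonneg zero_le_power) (auto simp: z_def field_simps)
      ultimately show "\<exists>y. ((\<lambda>s. s^2 * (1-s)^(n-1)) has_real_derivative y) (at s) \<and> 0 \<le> y" by auto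
    qed
    then show ?thesis unfolding f_def
      using mult_left_mono[of _ _ "real (Suc n) * (real (Suc n) - 1)"] by (simp add: mult.assoc)
  qed
  then have "f (Suc n) t \<le> 3/4" using big[of z] big[of t] z step.prems by linarith
  then show ?case by (simp add: f_def)
qed

lemma times_power_le_half:
  fixes t :: real
  assumes "2 \<le> n" "0 \<le> t" "t \<le> 1"
  shows "real n * t * (1 - t)^(n-1) \<le> 1/2"
  using binomial_ge_twice_linear_term[of "1 - t" t n] assms by simp

lemma square_times_power_le':
  fixes t :: real
  assumes "3 \<le> n" "0 \<le> t" "t \<le> 1"
  shows "real n * (real n - 1) * t^2 * (1 - t)^(n-2) \<le> 8/9"
proof (cases "n = 3")
  case True
  \<comment> \<open>The maximum for \<open>n = 3\<close> is 8/9, attained at \<open>t = 2/3\<close>,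
    which is therefore a double zero of the difference.\<close>
  have "8/9 - 6 * t^2 * (1-t) = 6 * (t - 2/3)^2 * (t + 1/3)"
    by (simp add: power2_eq_square field_simps)
  moreover have "0 \<le> 6 * (t - 2/3)^2 * (t + 1/3)" using assms by simp
  ultimately have "6 * t^2 * (1-t) \<le> 8/9" by linarith
  then show ?thesis using True by simp
next
  case False
  then show ?thesis using square_times_power_le[of n t] assms by simp
qed

lemma binomial_ge_twice_quadratic_term:
  fixes r s :: real
  assumes "3 \<le> n" "0 \<le> r" "0 \<le> s"
  shows "real n * (real n - 1) * s^2 * r^(n-2) \<le> (r + s)^n"
proof (cases "r + s = 0")
  case True
  then have "s = 0" using assms by linarith
  then show ?thesis using assms by simp
next
  case False
  then have pos: "r + s > 0" using assms by linarith
  let ?t = "s / (r + s)"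
  have "1 - ?t = r / (r + s)" using pos by (simp add: field_simps)
  moreover have "real n * (real n - 1) * ?t^2 * (1 - ?t)^(n-2) \<le> 8/9"
    using assms pos by (intro square_times_power_le') (auto simp: field_simps)
  ultimately have "real n * (real n - 1) * (s / (r + s))^2 * (r / (r + s))^(n-2) \<le> 1" by simp
  moreover have "n = 2 + (n - 2)" using assms(1) by simp
  then have "(r + s)^n = (r + s)^2 * (r + s)^(n - 2)" by (metis power_add)
  moreover have "real n * (real n - 1) * (s / (r + s))^2 * (r / (r + s))^(n-2)
      = real n * (real n - 1) * s^2 * r^(n-2) / ((r + s)^2 * (r + s)^(n - 2))"
    by (simp add: power_divide)
  ultimately show ?thesis using pos by (simp only: divide_le_eq_1_pos zero_less_power mult_pos_pos)
qed

text \<open>The complete homogeneous symmetric polynomial \<open>\<Sum>i\<le>k. u^i * w^(k-i)\<close>.\<close>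

primrec hom_sym :: "real \<Rightarrow> real \<Rightarrow> nat \<Rightarrow> real" where
  "hom_sym u w 0 = 1"
| "hom_sym u w (Suc k) = u * hom_sym u w k + w^(Suc k)"

lemma hom_sym_diff: "(u - w) * hom_sym u w k = u^(Suc k) - w^(Suc k)"
proof (induction k)
  case (Suc k)
  have "(u - w) * hom_sym u w (Suc k) = u * ((u - w) * hom_sym u w k) + (u - w) * w^(Suc k)"
    by (simp add: algebra_simps)
  then show ?case unfolding Suc by (simp add: algebra_simps)
qed simp

lemma hom_sym_nonneg: "0 \<le> u \<Longrightarrow> 0 \<le> w \<Longrightarrow> 0 \<le> hom_sym u w k"
  by (induction k) auto

lemma hom_sym_le:
  assumes "0 \<le> w" "w \<le> u"
  shows "hom_sym u w k \<le> real (Suc k) * u^k"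
proof (induction k)
  case (Suc k)
  have "u * hom_sym u w k \<le> u * (real (Suc k) * u^k)" using Suc assms by (intro mult_left_mono) auto
  moreover have "w^(Suc k) \<le> u^(Suc k)" using assms by (intro power_mono) auto
  ultimately show ?case by (simp add: algebra_simps)
qed simp

text \<open>By the recurrence with coefficients \<open>u + w\<close> and \<open>- u * w\<close>,
  each increment is at most \<open>r\<close> times the previous one. The hypotheses fit
  \<open>u = 1 - y\<close>, \<open>w = 1 - x\<close>, \<open>r = 1 - x - y\<close>, where
  \<open>u * w = r + x * y\<close>.\<close>

lemma hom_sym_increment_le:
  assumes "0 \<le> u" "0 \<le> w" "0 \<le> r" "u + w = 1 + r" "r \<le> u * w"
  shows "hom_sym u w (Suc k) - hom_sym u w k \<le> r^(Suc k)"
proof (induction k)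
  case (Suc k)
  have "hom_sym u w (Suc (Suc k)) = (u + w) * hom_sym u w (Suc k) - u * w * hom_sym u w k"
    by (simp add: algebra_simps)
  then have "hom_sym u w (Suc (Suc k)) - hom_sym u w (Suc k)
     = r * (hom_sym u w (Suc k) - hom_sym u w k) - (u * w - r) * hom_sym u w k"
    unfolding assms(4) by (simp only: algebra_simps)
  moreover have "r * (hom_sym u w (Suc k) - hom_sym u w k) \<le> r * r^(Suc k)"
    using Suc assms by (intro mult_left_mono) auto
  moreover have "0 \<le> (u * w - r) * hom_sym u w k"
    using assms hom_sym_nonneg by simp
  ultimately show ?case by simp
qed (use assms in simp)

lemma hom_sym_le_geometric:
  assumes "0 \<le> u" "0 \<le> w" "0 \<le> r" "r \<le> 1" "u + w = 1 + r" "r \<le> u * w"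
  shows "(1 - r) * (hom_sym u w k - 1) \<le> r * (1 - r^k)"
proof (induction k)
  case (Suc k)
  have "(1 - r) * (hom_sym u w (Suc k) - hom_sym u w k) \<le> (1 - r) * r^(Suc k)"
    using hom_sym_increment_le[of u w r k] assms by (intro mult_left_mono) auto
  then have "(1 - r) * (hom_sym u w (Suc k) - 1) \<le> r * (1 - r^k) + (1 - r) * r^(Suc k)"
    using Suc by (simp only: algebra_simps)
  then show ?case by (simp add: algebra_simps)
qed simp

lemma gap_times_power_le_one:
  assumes "0 \<le> (w::real)" "w \<le> 1"
  shows "real (Suc k) * (1 - w) * w^k \<le> 1"
proof -
  \<comment> \<open>The right side is \<open>1 - w\<close> times a geometric sum of
    \<open>k + 1\<close> terms, each at least \<open>w^k\<close>.\<close>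
  have "real (Suc k) * w^k * (1 - w) \<le> 1 - w^(Suc k)"
  proof (induction k)
    case (Suc k)
    have "w * (real (Suc k) * w^k * (1 - w)) \<le> w * (1 - w^(Suc k))"
      using Suc assms by (intro mult_left_mono) auto
    moreover have "w^(Suc k) * (1 - w) \<le> 1 * (1 - w)"
      using assms by (intro mult_right_mono power_le_one) auto
    ultimately show ?case by (simp add: algebra_simps)
  qed simp
  moreover have "0 \<le> w^(Suc k)" using assms by simp
  ultimately show ?thesis by (simp add: algebra_simps)
qed

text \<open>The three cases of the bound \<open>hom_sym_weighted_le\<close> use different estimates of \<open>hom_sym\<close>: only its
  relation to \<open>u^(K+1) - w^(K+1)\<close> when \<open>K y \<le> 1 - x - y\<close>, the geometric bound when \<open>K y < 1\<close>, and
  \<open>(K+1) u^K\<close> when \<open>K y \<ge> 1\<close>, where the claim becomes linear in \<open>x\<close>.\<close>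

lemma hom_sym_weighted_le_small:
  fixes x y :: real
  assumes "0 \<le> y" "y \<le> x" "x + y \<le> 1" "1 \<le> K" "real K * y \<le> 1 - x - y"
  shows "y * (real K * x - (1 - x - y)) * hom_sym (1 - y) (1 - x) K
     \<le> (1 - x - y) * (1 - (1 - x)^(Suc K)) + real K * x * y"
proof -
  let ?u = "1 - y" and ?w = "1 - x" and ?r = "1 - x - y" and ?S = "hom_sym (1 - y) (1 - x) K"
  have S0: "0 \<le> ?S" using assms by (intro hom_sym_nonneg) auto
  have eq: "(x - y) * ?S = ?u^(Suc K) - ?w^(Suc K)" using hom_sym_diff[of ?u ?w K] by simp
  \<comment> \<open>Splitting \<open>x\<close> into \<open>x - y\<close> and \<open>y\<close> leaves
    \<open>hom_sym\<close> itself only with the nonpositive factor \<open>K * y - r\<close>.\<close>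
  have "y * (real K * x - ?r) * ?S = y * real K * (?u^(Suc K) - ?w^(Suc K)) + y * (real K * y - ?r) * ?S"
    unfolding eq[symmetric] by (simp add: algebra_simps)
  moreover have "y * (real K * y - ?r) * ?S \<le> 0"
    using assms S0 by (intro mult_nonpos_nonneg mult_nonneg_nonpos) auto
  moreover have "?w^(Suc K) \<le> ?u^(Suc K)" using assms by (intro power_mono) auto
  then have "y * real K * (?u^(Suc K) - ?w^(Suc K)) \<le> ?r * (?u^(Suc K) - ?w^(Suc K))"
    using assms by (intro mult_right_mono) (auto simp: mult.commute)
  moreover have "?u^(Suc K) \<le> 1" using assms by (intro power_le_one) auto
  then have "?r * (?u^(Suc K) - ?w^(Suc K)) \<le> ?r * (1 - ?w^(Suc K))"
    using assms by (intro mult_left_mono) auto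
  moreover have "0 \<le> real K * x * y" using assms by simp
  ultimately show ?thesis by linarith
qed

lemma hom_sym_weighted_le_medium:
  fixes x y :: real
  assumes "0 \<le> y" "y \<le> x" "x + y \<le> 1" "1 \<le> K" "1 - x - y < real K * y" "real K * y < 1"
  shows "y * (real K * x - (1 - x - y)) * hom_sym (1 - y) (1 - x) K
     \<le> (1 - x - y) * (1 - (1 - x)^(Suc K)) + real K * x * y"
proof -
  define r where "r = 1 - x - y"
  let ?u = "1 - y" and ?w = "1 - x" and ?S = "hom_sym (1 - y) (1 - x) K"
  have r: "0 \<le> r" "r < real K * y" "r \<le> 1" and r1: "1 - r = x + y" using assms by (auto simp: r_def)
  have y: "0 < y" using assms by (cases "y = 0") auto
  have xy: "0 < x + y" using assms y by linarith
  have "r \<le> ?u * ?w" using assms by (simp add: r_def algebra_simps)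
  then have geo: "(x + y) * (?S - 1) \<le> r * (1 - r^K)"
    using hom_sym_le_geometric[of ?u ?w r K] assms r unfolding r1 by (simp add: r_def)
  have Kx: "0 \<le> real K * x - r" using r mult_left_mono[of y x "real K"] assms by linarith
  have yK: "y * (real K * x - r) \<le> x - y * r"
    using mult_right_mono[of "real K * y" 1 x] assms by (simp add: algebra_simps)
  have rK: "0 \<le> 1 - r^K" "0 \<le> r^K" using r by (auto intro: power_le_one)
  \<comment> \<open>Since \<open>w = r + y < (K + 1) * y\<close>, the factor \<open>K + 1\<close> is
    absorbed by \<open>gap_times_power_le_one\<close>; the two summands of \<open>x + y\<close>
    contribute at most \<open>y\<close> each.\<close>
  have w: "(x + y) * ?w^(Suc K) \<le> 2 * y"
  proof -
    have "real (Suc K) * x * ?w^K \<le> 1" using gap_times_power_le_one[of ?w K] assms by simp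
    then have "y * (real (Suc K) * x * ?w^K) \<le> y * 1" using y by (intro mult_left_mono) auto
    moreover have "?w \<le> real (Suc K) * y" using r by (simp add: r_def algebra_simps)
    then have "?w * (x * ?w^K) \<le> real (Suc K) * y * (x * ?w^K)"
      using assms by (intro mult_right_mono) auto
    moreover have "y * ?w^(Suc K) \<le> y * 1"
      using assms by (intro mult_left_mono power_le_one) auto
    ultimately show ?thesis by (simp add: algebra_simps)
  qed
  have key: "y * (real K * x - r) * (1 - r^K) \<le> (x + y) * (1 + y - ?w^(Suc K))"
  proof -
    have "y * (real K * x - r) * (1 - r^K) \<le> (x - y * r) * (1 - r^K)"
      using yK rK by (intro mult_right_mono) auto
    moreover have "y * r \<le> x" using assms r by (metis mult_left_le order_trans)
    then have "0 \<le> (x - y * r) * r^K" using rK by (intro mult_nonneg_nonneg) auto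
    moreover have "(x + y) * (1 + y) - (x - y * r) = 2 * y"
      by (simp add: r_def algebra_simps)
    ultimately show ?thesis using w by (simp only: algebra_simps)
  qed
  \<comment> \<open>Everything is multiplied by \<open>x + y = 1 - r\<close>, the factor in front of
    the geometric bound, and \<open>hom_sym\<close> is split into 1 and its excess over 1.\<close>
  have "(x + y) * (y * (real K * x - r) * ?S)
     = y * (real K * x - r) * ((x + y) * (?S - 1)) + (x + y) * (y * (real K * x - r))"
    by (simp add: algebra_simps)
  also have "\<dots> \<le> y * (real K * x - r) * (r * (1 - r^K)) + (x + y) * (y * (real K * x - r))"
    using geo y Kx by (intro add_right_mono mult_left_mono) auto
  also have "\<dots> = r * (y * (real K * x - r) * (1 - r^K)) + (x + y) * (y * (real K * x - r))" by simp
  also have "\<dots> \<le> r * ((x + y) * (1 + y - ?w^(Suc K))) + (x + y) * (y * (real K * x - r))"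
    using key r by (intro add_right_mono mult_left_mono) auto
  also have "\<dots> = (x + y) * (r * (1 - ?w^(Suc K)) + real K * x * y)"
    by (simp only: algebra_simps)
  finally show ?thesis using xy unfolding r_def by (simp only: mult_le_cancel_left_pos)
qed

text \<open>Bernoulli's inequality for the reciprocal \<open>1 / (1 - y) = 1 + y / (1 - y)\<close>.
  The hypothesis \<open>1 \<le> K * y\<close> means \<open>K * (1 - y) \<le> K - 1\<close>, which
  makes up for the exponent \<open>K - 1\<close>.\<close>

lemma power_times_linear_le_one:
  fixes y :: real
  assumes "1 \<le> K" "1 \<le> real K * y" "y < 1"
  shows "(1 - y)^(K-1) * (1 + real K * y) \<le> 1"
proof -
  have "0 < real K * y" using assms by linarith
  then have "0 < y" by (simp add: zero_less_mult_iff)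
  note y = assms(3) this
  obtain k where k: "K = Suc k" using assms by (cases K) auto
  have "(1 + real k * (y / (1 - y))) \<le> (1 + y / (1 - y))^k"
    using y by (intro Bernoulli_inequality) (simp add: divide_simps)
  also have "1 + y / (1 - y) = 1 / (1 - y)" using y by (simp add: field_simps)
  finally have "(1 - y)^k * (1 + real k * (y / (1 - y))) \<le> (1 - y)^k * (1 / (1 - y))^k"
    using y by (intro mult_left_mono) auto
  also have "\<dots> = 1" using y by (simp add: power_divide)
  finally have *: "(1 - y)^k * (1 + real k * (y / (1 - y))) \<le> 1" .
  have "real K * y \<le> real k * (y / (1 - y))"
  proof -
    have "real K * (1 - y) \<le> real k" using assms by (simp add: k algebra_simps)
    then have "real K * (1 - y) * y \<le> real k * y" using y by (intro mult_right_mono) auto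
    then show ?thesis using y by (simp add: field_simps)
  qed
  then have "(1 - y)^k * (1 + real K * y) \<le> (1 - y)^k * (1 + real k * (y / (1 - y)))"
    using y by (intro mult_left_mono) auto
  then show ?thesis using * by (simp add: k)
qed

lemma hom_sym_weighted_le_large:
  fixes x y :: real
  assumes "0 \<le> y" "y \<le> x" "x + y \<le> 1" "1 \<le> K" "1 \<le> real K * y"
  shows "y * (real K * x - (1 - x - y)) * hom_sym (1 - y) (1 - x) K
     \<le> (1 - x - y) * (1 - (1 - x)^(Suc K)) + real K * x * y"
proof -
  define r where "r = 1 - x - y"
  define u where "u = 1 - y"
  define w where "w = 1 - x"
  let ?S = "hom_sym u w K"
  \<comment> \<open>\<open>f x\<close> is the slack left once \<open>hom_sym\<close> is replaced by
    \<open>(K + 1) * u^K\<close>. It is affine in \<open>z\<close>, so nonnegativity at the two ends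
    \<open>y\<close> and \<open>u\<close> of the range of \<open>x\<close> suffices.\<close>
  define f where "f = (\<lambda>z. (u + z * (real K * y - 1)) - y * u^K * (real K * (real K + 1) * y - u + (real K + 1) * z))"
  have y: "y \<le> 1/2" "0 < y" using assms by (auto simp: less_le)
  have "K \<noteq> 1" using assms y by auto
  then have K: "2 \<le> K" using assms by simp
  have u: "0 \<le> u" "u \<le> 1" "y \<le> u" using y by (auto simp: u_def)
  have Kp: "u^K = u * u^(K-1)" using K by (metis not_numeral_le_zero power_eq_if)
  have fu: "0 \<le> f u"
  proof -
    have "f u = real K * u * y * (1 - u^(K-1) * (1 + real K * y))"
      unfolding f_def Kp by (simp add: u_def algebra_simps)
    moreover have "u^(K-1) * (1 + real K * y) \<le> 1"
      using power_times_linear_le_one[of K y] assms y by (simp add: u_def)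
    ultimately show ?thesis using u y by simp
  qed
  have fy: "0 \<le> f y"
  proof (cases "K = 2")
    case True
    then have y2: "y = 1/2" using assms y by simp
    show ?thesis unfolding True f_def u_def y2 by (simp add: power2_eq_square)
  next
    case False
    define k where "k = real K"
    have k: "3 \<le> k" using False K by (simp add: k_def)
    \<comment> \<open>The bound for \<open>K + 2\<close> trials has the right exponent
      \<open>K\<close>, and its 3/4 leaves room for \<open>1 - 1 / K\<close>, the minimum of
      \<open>1 - 2 * y + K * y^2\<close> over \<open>y\<close>.\<close>
    have "real (K + 2) * (real (K + 2) - 1) * y^2 * (1 - y)^(K + 2 - 2) \<le> 3/4"
      using K y assms by (intro square_times_power_le) auto
    then have "(k + 2) * (k + 1) * y^2 * u^K \<le> 3/4" by (simp add: u_def k_def algebra_simps)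
    then have "(k + 1) / (k + 2) * ((k + 2) * (k + 1) * y^2 * u^K) \<le> (k + 1) / (k + 2) * (3/4)"
      using k by (intro mult_left_mono) auto
    moreover have "(k + 1) / (k + 2) * ((k + 2) * (k + 1) * y^2 * u^K) = (k + 1)^2 * y^2 * u^K"
      using k by (simp add: power2_eq_square)
    moreover have "(k + 1) / (k + 2) * (3/4) \<le> 1 - 1/k"
    proof -
      have "3 * 1 \<le> k * (k - 2)" using k by (intro mult_mono) auto
      then show ?thesis using k by (simp add: field_simps)
    qed
    moreover have "1 - 1/k \<le> 1 - 2 * y + k * y^2"
    proof -
      have "0 \<le> (k * y - 1)^2 / k" using k by simp
      also have "\<dots> = k * y^2 - 2 * y + 1/k" using k by (simp add: power2_eq_square field_simps)
      finally show ?thesis by simp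
    qed
    moreover have "0 \<le> y * u^K * u" using u y by simp
    moreover have "f y = 1 - 2 * y + k * y^2 - (k + 1)^2 * y^2 * u^K + y * u^K * u"
      by (simp add: f_def k_def power2_eq_square u_def algebra_simps)
    ultimately show ?thesis by linarith
  qed
  have fx: "0 \<le> f x"
  proof -
    define q where "q = (real K * y - 1) - y * u^K * (real K + 1)"
    have "f x = f y + q * (x - y)" "f x = f u + q * (x - u)"
      by (simp_all add: f_def q_def algebra_simps)
    moreover have "x \<le> u" using assms by (simp add: u_def)
    moreover have "0 \<le> q * (x - y) \<or> 0 \<le> q * (x - u)"
      using assms(2) \<open>x \<le> u\<close> by (cases "0 \<le> q") (auto simp: mult_nonpos_nonpos)
    ultimately show ?thesis using fu fy by linarith
  qed
  have r: "0 \<le> r" "r \<le> real K * y" and w: "0 \<le> w" "w \<le> u" using assms by (auto simp: r_def w_def u_def)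
  have eq: "(x - y) * ?S = u^(Suc K) - w^(Suc K)" using hom_sym_diff[of u w K] by (simp add: u_def w_def)
  have "y * (real K * x - r) * ?S = y * real K * (u^(Suc K) - w^(Suc K)) + y * (real K * y - r) * ?S"
    unfolding eq[symmetric] by (simp only: algebra_simps)
  also have "\<dots> \<le> y * real K * (u^(Suc K) - w^(Suc K)) + y * (real K * y - r) * (real (Suc K) * u^K)"
    using hom_sym_le[OF w] r y by (intro add_left_mono mult_left_mono) auto
  also have "\<dots> = r + real K * x * y - real K * y * w^(Suc K) - f x"
    by (simp add: f_def r_def u_def algebra_simps)
  also have "\<dots> \<le> r + real K * x * y - r * w^(Suc K)"
    using fx mult_right_mono[OF r(2), of "w^(Suc K)"] w by simp
  finally show ?thesis by (simp add: r_def u_def w_def algebra_simps)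
qed

text \<open>This is what remains of the comparison of two unequal channels after \<open>v\<close>
  has been eliminated and the factor \<open>x - y\<close> divided out; \<open>hom_sym\<close> enters
  as the quotient of \<open>u^N - w^N\<close> by \<open>x - y\<close>.\<close>

lemma hom_sym_weighted_le:
  fixes x y :: real
  assumes "0 \<le> y" "y \<le> x" "x + y \<le> 1" "1 \<le> K"
  shows "y * (real K * x - (1 - x - y)) * hom_sym (1 - y) (1 - x) K
     \<le> (1 - x - y) * (1 - (1 - x)^(Suc K)) + real K * x * y"
  using hom_sym_weighted_le_small[OF assms] hom_sym_weighted_le_medium[OF assms] hom_sym_weighted_le_large[OF assms] by linarith

section \<open>One-slot optimality forces symmetry\<close>

text \<open>With \<open>N\<close> opponents and \<open>c\<^sub>i\<close> of them on channel \<open>i\<close>, \<open>prob_one\<close> and \<open>prob_both\<close> are the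
  probabilities of \<open>c\<^sub>1 = 1\<close> and of \<open>c\<^sub>1 = c\<^sub>2 = 1\<close>.  A gain is the expected drop from \<open>v\<close> to the
  continuation value (0 after success): on channel 1 it is
  \<open>v P(c\<^sub>1 = 0) + (v - b) P(c\<^sub>1 \<ge> 1, c\<^sub>2 = 1)\<close>.\<close>

definition prob_one :: "nat \<Rightarrow> real \<Rightarrow> real" where
  "prob_one N x = real N * x * (1 - x)^(N-1)"

definition prob_both :: "nat \<Rightarrow> real \<Rightarrow> real \<Rightarrow> real" where
  "prob_both N x y = real N * (real N - 1) * x * y * (1 - x - y)^(N-2)"

definition gain_silent :: "nat \<Rightarrow> real \<Rightarrow> real \<Rightarrow> real \<Rightarrow> real \<Rightarrow> real \<Rightarrow> real" where
  "gain_silent N x y b c v = (v - b) * (prob_one N x + prob_one N y - 2 * prob_both N x y) + (v - c) * prob_both N x y"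

definition gain_transmit :: "nat \<Rightarrow> real \<Rightarrow> real \<Rightarrow> real \<Rightarrow> real \<Rightarrow> real" where
  "gain_transmit N x y b v = v * (1 - x)^N + (v - b) * (prob_one N y - real N * y * (1 - x - y)^(N-1))"

definition one_slot_eq :: "nat \<Rightarrow> real \<Rightarrow> real \<Rightarrow> real \<Rightarrow> real \<Rightarrow> real \<Rightarrow> bool" where
  "one_slot_eq N b c x y v \<longleftrightarrow> 0 \<le> x \<and> 0 \<le> y \<and> x + y \<le> 1 \<and>
     gain_transmit N x y b v \<le> 1 \<and> gain_transmit N y x b v \<le> 1 \<and> gain_silent N x y b c v \<le> 1 \<and>
     (0 < x \<longrightarrow> gain_transmit N x y b v = 1) \<and> (0 < y \<longrightarrow> gain_transmit N y x b v = 1) \<and>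
     (x + y < 1 \<longrightarrow> gain_silent N x y b c v = 1)"

text \<open>Here \<open>b\<close> and \<open>c\<close> are the equilibrium latencies with \<open>N\<close> and \<open>N - 1\<close> pending players.  Up to
  \<open>N = 3\<close> the general estimates fail, so these values are kept explicitly.\<close>

definition admissible :: "nat \<Rightarrow> real \<Rightarrow> real \<Rightarrow> bool" where
  "admissible N b c \<longleftrightarrow> 1 \<le> N \<and> 0 \<le> c \<and> c < b \<and> b \<le> 2^(N-1) \<and> (N = 1 \<longrightarrow> b = 1 \<and> c = 0) \<and>
     (N = 2 \<longrightarrow> b = 2 \<and> c = 1) \<and> (N = 3 \<longrightarrow> b = 8/3 \<and> c = 2) \<and>
     (4 \<le> N \<longrightarrow> 4 \<le> b \<and> 3 * (b - c) \<le> 2 * b)"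

lemma prob_both_commute: "prob_both N x y = prob_both N y x"
  by (simp add: prob_both_def algebra_simps)

lemma gain_silent_commute: "gain_silent N x y b c v = gain_silent N y x b c v"
  by (simp add: gain_silent_def prob_both_commute add.commute)

lemma one_slot_eq_commute: "one_slot_eq N b c x y v \<longleftrightarrow> one_slot_eq N b c y x v"
  unfolding one_slot_eq_def by (auto simp: gain_silent_commute[of N x y] add.commute)

lemma one_slot_eq_pos_aux:
  assumes "one_slot_eq N b c x y v" "1 \<le> N"
  shows "0 < y"
proof (rule ccontr)
  assume "\<not> 0 < y"
  then have y: "y = 0" and x: "0 \<le> x" "x \<le> 1" using assms by (auto simp: one_slot_eq_def)
  have v: "v \<le> 1" using assms x y by (simp add: one_slot_eq_def gain_transmit_def prob_one_def)
  show False
  proof (cases "x = 0")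
    case True
    then show False using assms y by (simp add: one_slot_eq_def gain_silent_def prob_one_def prob_both_def)
  next
    case False
    then have eq: "v * (1 - x)^N = 1"
      using assms x y by (simp add: one_slot_eq_def gain_transmit_def prob_one_def)
    have "v > 0"
    proof (rule ccontr)
      assume "\<not> v > 0"
      then have "v * (1 - x)^N \<le> 0" using x by (intro mult_nonpos_nonneg) auto
      then show False using eq by simp
    qed
    moreover have "(1 - x)^N < 1" using x False assms by (simp add: power_less_one_iff)
    ultimately have "v * (1 - x)^N < 1 * 1" using v x by (intro mult_le_less_imp_less) auto
    then show False using eq by simp
  qed
qed

lemma one_slot_eq_pos:
  assumes "one_slot_eq N b c x y v" "1 \<le> N"
  shows "0 < x" "0 < y"
  using one_slot_eq_pos_aux[OF assms] one_slot_eq_pos_aux[of N b c y x v] assms one_slot_eq_commute by auto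

text \<open>Since channel 1 is at least as good as silence, \<open>v\<close> dominates a multiple of \<open>v - b\<close>; the equality
  of the two channel gains bounds it by a smaller multiple.\<close>

lemma no_asymmetric_equilibrium:
  assumes "1 \<le> N" "0 < y" "y < x" "x + y \<le> 1" "c < b" "b \<le> v" "0 < v"
    and eq: "gain_transmit N x y b v = gain_transmit N y x b v" and le: "gain_silent N x y b c v \<le> gain_transmit N x y b v"
  shows False
proof (cases "N = 1")
  case True
  then show False using assms by (simp add: gain_transmit_def prob_one_def)
next
  case False
  then obtain k where N: "N = Suc (Suc k)" using assms(1) by (metis One_nat_def not_one_le_zero old.nat.exhaust)
  let ?K = "Suc k"
  define r u w d where "r = 1 - x - y" and "u = 1 - y" and "w = 1 - x" and "d = v - b"
  define S where "S = hom_sym u w ?K"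
  define P where "P = u^N - w^N"
  have r0: "0 \<le> r" and w0: "0 < w" and wu: "w < u" using assms by (auto simp: r_def u_def w_def)
  have P: "P = (x - y) * S" using hom_sym_diff[of u w ?K] by (simp add: P_def S_def N u_def w_def)
  have P0: "0 < P" using wu w0 by (simp add: P_def N power_strict_mono del: power_Suc)
  define B where "B = real N * real ?K * x * y * r^k"
  have B: "prob_both N x y = B" by (simp add: prob_both_def B_def N r_def)
  have sx: "prob_one N x = real N * x * w^?K" "prob_one N y = real N * y * u^?K"
    by (simp_all add: prob_one_def N w_def u_def)
  have r': "1 - y - x = r" by (simp add: r_def)
  have g: "gain_transmit N x y b v = v * w^N + d * (real N * y * u^?K - real N * y * r^?K)"
     "gain_transmit N y x b v = v * u^N + d * (real N * x * w^?K - real N * x * r^?K)"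
     "gain_silent N x y b c v = d * (real N * x * w^?K + real N * y * u^?K - 2 * B) + (v - c) * B"
    unfolding gain_transmit_def gain_silent_def B sx r'
    unfolding r_def[symmetric] unfolding w_def[symmetric] u_def[symmetric] d_def[symmetric]
    by (simp_all only: N diff_Suc_1)
  define D1 where "D1 = real N * x * w^?K - B + real N * y * r^?K"
  define Ev where "Ev = real N * (y * u^?K - x * w^?K + (x - y) * r^?K)"
  have e: "v * P = d * Ev"
    using eq unfolding g P_def Ev_def by (simp only: algebra_simps)
  have c1: "d * D1 + (b - c) * B \<le> v * w^N"
  proof -
    have "(v - c) * B = d * B + (b - c) * B" by (simp add: d_def algebra_simps)
    then show ?thesis using le unfolding g D1_def by (simp add: algebra_simps)
  qed
  \<comment> \<open>Multiplication by \<open>P > 0\<close> produces \<open>v * P\<close>, which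
    equals \<open>d * Ev\<close>; this removes \<open>v\<close>, and the sign of the coefficient of
    \<open>d\<close> decides.\<close>
  have "(d * D1 + (b - c) * B) * P \<le> v * w^N * P" using c1 P0 by (intro mult_right_mono) auto
  also have "\<dots> = w^N * (v * P)" by simp
  finally have main: "d * (D1 * P - Ev * w^N) + (b - c) * B * P \<le> 0"
    unfolding e by (simp only: algebra_simps)
  define T where "T = (u * w)^?K - r^?K * w^N - y * r^k * (real ?K * x - r) * S"
  have DT: "D1 * P - Ev * w^N = real N * (x - y) * T"
  proof -
    have "D1 * P - Ev * w^N = real N * (x * w^?K * u^N - y * u^?K * w^N - (x - y) * r^?K * w^N
       - y * r^k * (real ?K * x - r) * P)"
    proof -
      have "r^?K = r * r^k" by simp
      then show ?thesis unfolding D1_def Ev_def B_def P_def by (simp only: algebra_simps)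
    qed
    also have "x * w^?K * u^N - y * u^?K * w^N = (u * w)^?K * (x * u - y * w)"
      by (simp add: N power_mult_distrib algebra_simps)
    also have "x * u - y * w = x - y" by (simp add: u_def w_def algebra_simps)
    finally show ?thesis unfolding P T_def by (simp only: algebra_simps)
  qed
  have uw: "u * w = r + x * y" by (simp add: u_def w_def r_def algebra_simps)
  have T0: "0 \<le> T"
  proof -
    \<comment> \<open>The first two binomial terms of \<open>(u * w)^K\<close>, where
      \<open>u * w = r + x * y\<close>, match exactly the right side of
      \<open>hom_sym_weighted_le\<close> times \<open>r^k\<close>.\<close>
    have bin: "r^Suc j + real (Suc j) * (x * y) * r^j \<le> (r + x * y)^Suc j" for j
    proof (induction j)
      case (Suc j)
      have "(r + x * y) * (r^Suc j + real (Suc j) * (x * y) * r^j) \<le> (r + x * y) * (r + x * y)^Suc j"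
        using Suc r0 assms by (intro mult_left_mono) auto
      moreover have "0 \<le> real (Suc j) * (x * y) * (x * y) * r^j" using r0 assms by simp
      ultimately show ?case by (simp add: algebra_simps)
    qed simp
    have "y * (real ?K * x - r) * S \<le> r * (1 - w^N) + real ?K * x * y"
      unfolding r_def S_def u_def w_def N using assms by (intro hom_sym_weighted_le) auto
    then have "r^k * (y * (real ?K * x - r) * S) \<le> r^k * (r * (1 - w^N) + real ?K * x * y)"
      using r0 by (intro mult_left_mono) auto
    moreover have "T = (r + x * y)^?K - r^?K * w^N - r^k * (y * (real ?K * x - r) * S)"
      unfolding T_def uw by (simp only: mult_ac)
    moreover have "r^k * (r * (1 - w^N) + real ?K * x * y) = r^?K - r^?K * w^N + real ?K * (x * y) * r^k"
      by (simp add: right_diff_distrib distrib_left mult_ac)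
    ultimately show ?thesis using bin[of k] by linarith
  qed
  have d0: "0 \<le> d" using assms by (simp add: d_def)
  have dN: "0 \<le> d * (real N * (x - y) * T)" using d0 T0 assms by simp
  show False
  \<comment> \<open>\<open>B\<close> vanishes exactly in this case; strictness then has to come from
    \<open>T\<close> instead of from \<open>(b - c) * B * P\<close>.\<close>
  proof (cases "r = 0 \<and> k \<noteq> 0")
    case False
    then have "0 < r^k" using r0 by (cases "k = 0") auto
    then have "0 < B" using assms(2,3) unfolding B_def N by (intro mult_pos_pos) auto
    then have "0 < (b - c) * B * P" using P0 assms by simp
    then show False using main dN unfolding DT by linarith
  next
    case True
    then have "T = (u * w)^?K" by (simp add: T_def)
    then have "0 < T" using w0 wu by simp
    moreover have "d \<noteq> 0" using e P0 assms by auto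
    ultimately have "0 < d * (real N * (x - y) * T)" using d0 assms by (simp add: N)
    moreover have "0 \<le> (b - c) * B * P" using P0 assms r0 by (simp add: B_def)
    ultimately show False using main unfolding DT by linarith
  qed
qed

text \<open>Given a single opponent on channel 1, the other \<open>N - 1 \<ge> 2\<close> opponents
  put exactly one on channel 2 with probability at most 1/2.\<close>

lemma prob_both_le_prob_one:
  assumes "3 \<le> N" "0 < x" "0 < y" "x + y < 1"
  shows "2 * prob_both N x y \<le> prob_one N x"
proof -
  have "2 * real (N - 1) * y * (1 - x - y)^(N - 1 - 1) \<le> ((1 - x - y) + y)^(N-1)"
    using assms by (intro binomial_ge_twice_linear_term) auto
  then have "real N * x * (2 * real (N - 1) * y * (1 - x - y)^(N - 1 - 1)) \<le> real N * x * (1 - x)^(N-1)"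
    using assms by (intro mult_left_mono) auto
  moreover have "real (N - 1) = real N - 1" "N - 1 - 1 = N - 2" using assms by auto
  ultimately show ?thesis unfolding prob_both_def prob_one_def by (simp add: algebra_simps)
qed

text \<open>Only the product \<open>x * y\<close> and the sum \<open>x + y\<close> occur in
  \<open>prob_both\<close>, so both probabilities may be replaced by their geometric mean
  \<open>s\<close>. Since \<open>2 * s \<le> x + y\<close>, the power \<open>(r + s)^N\<close> is at
  most the geometric mean of \<open>(1 - x)^N\<close> and \<open>(1 - y)^N\<close>.\<close>

lemma prob_both_le_prob_none:
  assumes "3 \<le> N" "0 < x" "0 < y" "x + y < 1"
  shows "2 * prob_both N x y \<le> (1 - x)^N + (1 - y)^N"
proof -
  define r where "r = 1 - x - y"
  define s where "s = sqrt (x * y)"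
  have s: "0 \<le> s" "s^2 = x * y" using assms by (auto simp: s_def)
  have r: "0 < r" using assms by (simp add: r_def)
  have "prob_both N x y = real N * (real N - 1) * s^2 * r^(N-2)" by (simp add: prob_both_def s r_def)
  also have "\<dots> \<le> (r + s)^N" using assms r s by (intro binomial_ge_twice_quadratic_term) auto
  finally have 1: "prob_both N x y \<le> (r + s)^N" .
  have "0 \<le> r * (sqrt x - sqrt y)^2" using r by simp
  also have "(sqrt x - sqrt y)^2 = x + y - 2 * s"
    using assms by (simp add: power2_diff s_def real_sqrt_mult)
  finally have "(r + s)^2 \<le> (r + y) * (r + x)"
    using s by (simp add: power2_eq_square algebra_simps)
  then have "((r + s)^2)^N \<le> ((r + y) * (r + x))^N" using r s by (intro power_mono) auto
  then have "((r + s)^N)^2 \<le> (1 - x)^N * (1 - y)^N"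
  proof -
    have "((r + s)^2)^N = ((r + s)^N)^2" by (simp only: power_mult[symmetric] mult.commute)
    moreover have "(r + y) * (r + x) = (1 - x) * (1 - y)" by (simp add: r_def)
    ultimately show ?thesis using \<open>((r + s)^2)^N \<le> _\<close> by (simp add: power_mult_distrib)
  qed
  moreover have "4 * ((1 - x)^N * (1 - y)^N) \<le> ((1 - x)^N + (1 - y)^N)^2"
    using zero_le_power2[of "(1 - x)^N - (1 - y)^N"] by (simp add: power2_eq_square algebra_simps)
  ultimately have "(2 * (r + s)^N)^2 \<le> ((1 - x)^N + (1 - y)^N)^2" by (simp add: power_mult_distrib)
  then have "2 * (r + s)^N \<le> (1 - x)^N + (1 - y)^N"
  proof (rule power2_le_imp_le)
    show "0 \<le> (1 - x)^N + (1 - y)^N" using assms by (intro add_nonneg_nonneg zero_le_power) auto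
  qed
  then show ?thesis using 1 by linarith
qed

text \<open>If \<open>v < b\<close>, the silence and the transmission equations both determine \<open>b - v\<close>, and the bounds on
  \<open>prob_both\<close> make the two values incompatible.\<close>

lemma latency_monotone:
  assumes inv: "admissible N b c" and eq: "one_slot_eq N b c x y v"
  shows "b \<le> v"
proof (rule ccontr)
  assume "\<not> b \<le> v"
  then have vb: "v < b" by simp
  have N: "1 \<le> N" and c: "0 \<le> c" "c < b" and b2: "b \<le> 2^(N-1)" using inv by (auto simp: admissible_def)
  have x: "0 < x" and y: "0 < y" using one_slot_eq_pos[OF eq N] by auto
  have xy: "x + y \<le> 1" using eq by (simp add: one_slot_eq_def)
  have g1: "gain_transmit N x y b v = 1" and g2: "gain_transmit N y x b v = 1" using eq x y by (auto simp: one_slot_eq_def)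
  define A1 A2 where "A1 = prob_one N x" and "A2 = prob_one N y"
  define B where "B = prob_both N x y"
  define C1 C2 where "C1 = real N * x * (1 - x - y)^(N-1)" and "C2 = real N * y * (1 - x - y)^(N-1)"
  define Z1 Z2 where "Z1 = (1 - x)^N" and "Z2 = (1 - y)^N"
  have e1: "v * Z1 + (v - b) * (A2 - C2) = 1"
    using g1 by (simp add: gain_transmit_def Z1_def A2_def C2_def)
  have e2: "v * Z2 + (v - b) * (A1 - C1) = 1"
  proof -
    have "1 - y - x = 1 - x - y" by simp
    then show ?thesis using g2 by (simp only: gain_transmit_def Z2_def A1_def C1_def)
  qed
  have CA1: "C1 \<le> A1" unfolding C1_def A1_def prob_one_def
    using x y xy by (intro mult_left_mono power_mono) auto
  have CA2: "C2 \<le> A2" unfolding C2_def A2_def prob_one_def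
    using x y xy by (intro mult_left_mono power_mono) auto
  have C0: "0 \<le> C1" "0 \<le> C2" using x y xy by (auto simp: C1_def C2_def)
  have Z0: "0 \<le> Z1" "0 \<le> Z2" using x y xy by (auto simp: Z1_def Z2_def)
  have B0: "0 \<le> B" using x y xy N by (auto simp: B_def prob_both_def)
  have "1 \<le> v * Z1" using e1 mult_nonpos_nonneg[of "v - b" "A2 - C2"] vb CA2 by simp
  then have bz1: "1 \<le> b * Z1" using mult_right_mono[of v b Z1] vb Z0 by linarith
  have "1 \<le> v * Z2" using e2 mult_nonpos_nonneg[of "v - b" "A1 - C1"] vb CA1 by simp
  then have bz2: "1 \<le> b * Z2" using mult_right_mono[of v b Z2] vb Z0 by linarith
  show False
  proof (cases "x + y = 1")
    case True
    \<comment> \<open>Without silence some channel is used with probability at least 1/2, so it is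
      free of opponents with probability at most \<open>(1/2)^N\<close>, too little for
      \<open>b \<le> 2^(N-1)\<close>.\<close>
    have "Z1 \<le> (1/2)^N \<or> Z2 \<le> (1/2)^N"
    proof (cases "1/2 \<le> x")
      case True
      then show ?thesis unfolding Z1_def using x y xy by (intro disjI1 power_mono) auto
    next
      case False
      then show ?thesis unfolding Z2_def using True x y xy by (intro disjI2 power_mono) auto
    qed
    then have "b * Z1 \<le> b * (1/2)^N \<or> b * Z2 \<le> b * (1/2)^N"
      using c by (auto intro: mult_left_mono)
    moreover have "b * (1/2)^N \<le> 2^(N-1) * (1/2)^N" using b2 by (intro mult_right_mono) auto
    moreover have "(2::real)^(N-1) * (1/2)^N = 1/2"
      using N by (cases N) (auto simp: power_divide)
    ultimately show False using bz1 bz2 by linarith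
  next
    case False
    then have r: "x + y < 1" using xy by simp
    then have "gain_silent N x y b c v = 1" using eq by (simp add: one_slot_eq_def)
    then have e0: "(v - b) * (A1 + A2 - B) + (b - c) * B = 1"
      by (simp add: gain_silent_def A1_def A2_def B_def algebra_simps)
    consider "N = 1" | "N = 2" | "3 \<le> N" using N by linarith
    then show False
    proof cases
      case 1
      then have "B = 0" "A1 + A2 = x + y" by (auto simp: B_def A1_def A2_def prob_both_def prob_one_def)
      then show False using e0 vb x y mult_neg_pos[of "v - b" "x + y"] by simp
    next
      case 2
      then have "b - c = 1" using inv by (simp add: admissible_def)
      moreover have B: "B = 2 * x * y" using 2 by (simp add: B_def prob_both_def)
      moreover have "4 * (x * y) \<le> (x + y)^2" using zero_le_power2[of "x - y"] by (simp add: power2_eq_square algebra_simps)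
      then have "4 * (x * y) \<le> 1" using r x y power_le_one[of "x + y" 2] by linarith
      moreover have "A1 + A2 - B = 2 * (x * (1 - x)) + 2 * (y * (1 - y)) - 2 * (x * y)"
        using 2 B by (simp add: A1_def A2_def prob_one_def)
      moreover have "x * y \<le> x * (1 - x)" using x r by (intro mult_left_mono) auto
      moreover have "0 \<le> y * (1 - y)" using y x r by simp
      ultimately have "(v - b) * (A1 + A2 - B) \<le> 0" "(b - c) * B \<le> 1/2"
        using vb by (auto intro!: mult_nonpos_nonneg)
      then show False using e0 by linarith
    next
      case 3
      define A Z C where "A = A1 + A2" and "Z = Z1 + Z2" and "C = C1 + C2"
      have h1: "4 * B \<le> A"
        using prob_both_le_prob_one[OF 3 x y r] prob_both_le_prob_one[OF 3 y x] r
        by (simp add: A_def A1_def A2_def B_def prob_both_commute[of N y x] add.commute)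
      have h2: "2 * B \<le> Z" using prob_both_le_prob_none[OF 3 x y r] by (simp add: Z_def Z1_def Z2_def B_def)
      have CA: "C \<le> A" "0 \<le> C" using CA1 CA2 C0 by (auto simp: A_def C_def)
      have A0: "0 \<le> A" using h1 B0 by simp
      define m where "m = b - v"
      have m: "0 < m" using vb by (simp add: m_def)
      have f0: "m * (A - B) = (b - c) * B - 1" using e0 by (simp add: m_def A_def algebra_simps)
      have f1: "m * (Z + A - C) = b * Z - 2"
        using e1 e2 by (simp add: m_def A_def Z_def C_def algebra_simps)
      have Z1: "0 < Z" using x y r by (simp add: Z_def Z1_def Z2_def add_pos_pos)
      have AB: "A - B > 0"
      proof -
        have "0 < A1" "0 < A2" using x y r 3 by (auto simp: A1_def A2_def prob_one_def)
        then show ?thesis using h1 by (simp add: A_def)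
      qed
      define X where "X = (b - c) * B"
      have X: "1 < X" using mult_pos_pos[OF m AB] f0 by (simp add: X_def)
      have XB: "X \<le> b * B" unfolding X_def using c B0 by (intro mult_right_mono) auto
      have "0 < C" using x y r 3 by (simp add: C_def C1_def C2_def add_pos_pos)
      then have "(X - 1) * (Z + A - C) < (X - 1) * (Z + A)" using X by (intro mult_strict_left_mono) auto
      then have "Z * ((X - 1) * (Z + A - C)) < Z * ((X - 1) * (Z + A))" using Z1 by simp
      also have "\<dots> = (Z * (X - 1)) * (Z + A)" by simp
      also have "\<dots> \<le> (B * (b * Z - 2)) * (Z + A)"
      proof (rule mult_right_mono)
        have "Z * X \<le> Z * (b * B)" using XB Z1 by simp
        then show "Z * (X - 1) \<le> B * (b * Z - 2)" using h2 by (simp add: algebra_simps)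
      qed (use Z1 A0 in simp)
      also have "\<dots> = (b * Z - 2) * (B * (Z + A))" by simp
      also have "\<dots> \<le> (b * Z - 2) * (Z * (A - B))"
      proof (rule mult_left_mono)
        \<comment> \<open>Each of the two bounds on \<open>B\<close> accounts for one half of
          \<open>Z * A\<close>.\<close>
        have "(4 * B) * Z \<le> A * Z" "(2 * B) * A \<le> Z * A" using h1 h2 Z1 A0 by (auto intro!: mult_right_mono)
        then show "B * (Z + A) \<le> Z * (A - B)" by (simp add: algebra_simps)
        show "0 \<le> b * Z - 2" using bz1 bz2 by (simp add: Z_def algebra_simps)
      qed
      finally have "(X - 1) * (Z + A - C) < (b * Z - 2) * (A - B)"
        using Z1 by (simp add: mult.left_commute[of _ Z])
      moreover have "(X - 1) * (Z + A - C) = (m * (A - B)) * (Z + A - C)"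
        by (simp add: f0 X_def)
      moreover have "(b * Z - 2) * (A - B) = (m * (Z + A - C)) * (A - B)"
        by (simp add: f1)
      ultimately show False by simp
    qed
  qed
qed

section \<open>The symmetric equations in terms of odds\<close>

text \<open>The coefficients of the one-slot equations at \<open>x = y = t / (1 + t)\<close> after multiplication by
  \<open>(1 + t)^N\<close>.\<close>

definition cond_one :: "nat \<Rightarrow> real \<Rightarrow> real" where
  "cond_one N t = (real N - 1) * t * (1 - t)^(N-2)"

definition transmit_coeff :: "nat \<Rightarrow> real \<Rightarrow> real" where
  "transmit_coeff N t = 1 + real N * t * (1 - (1 - t)^(N-1))"

definition silent_coeff :: "nat \<Rightarrow> real \<Rightarrow> real" where
  "silent_coeff N t = real N * t * (2 - cond_one N t)"

definition both_coeff :: "nat \<Rightarrow> real \<Rightarrow> real" where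
  "both_coeff N t = real N * t * cond_one N t"

definition odds_eq :: "nat \<Rightarrow> real \<Rightarrow> real \<Rightarrow> real \<Rightarrow> real \<Rightarrow> bool" where
  "odds_eq N b c t v \<longleftrightarrow> 0 < t \<and> t \<le> 1 \<and> b + (v - b) * transmit_coeff N t = (1 + t)^N \<and>
     (v - b) * silent_coeff N t + (b - c) * both_coeff N t \<le> (1 + t)^N \<and>
     (t < 1 \<longrightarrow> (v - b) * silent_coeff N t + (b - c) * both_coeff N t = (1 + t)^N)"

lemma prob_one_odds:
  assumes "0 < t" "1 \<le> N"
  shows "prob_one N (t / (1 + t)) = real N * t / (1 + t)^N"
proof -
  have "1 - t / (1 + t) = 1 / (1 + t)" using assms by (simp add: field_simps)
  moreover have "(1 + t)^N = (1 + t) * (1 + t)^(N - 1)" using assms by (simp flip: power_Suc)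
  ultimately show ?thesis by (simp add: prob_one_def power_divide)
qed

lemma gain_transmit_odds:
  assumes "0 < t" "1 \<le> N"
  shows "gain_transmit N (t / (1 + t)) (t / (1 + t)) b v = (b + (v - b) * transmit_coeff N t) / (1 + t)^N"
proof -
  have 1: "1 - t / (1 + t) = 1 / (1 + t)" "1 / (1 + t) - t / (1 + t) = (1 - t) / (1 + t)"
    using assms by (simp_all add: field_simps)
  have p: "(1 + t)^N = (1 + t) * (1 + t)^(N - 1)" using assms by (simp flip: power_Suc)
  have 2: "real N * (t / (1 + t)) * ((1 - t) / (1 + t))^(N-1) = real N * t * (1 - t)^(N-1) / (1 + t)^N"
    unfolding p by (simp add: power_divide)
  have 3: "(1 / (1 + t))^N = 1 / (1 + t)^N" by (simp add: power_divide)
  have "(1 + t)^N \<noteq> 0" "1 + t \<noteq> 0" using assms by simp_all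
  then show ?thesis
    unfolding gain_transmit_def prob_one_odds[OF assms] 1 2 3 transmit_coeff_def
    by (simp add: divide_simps) (simp add: algebra_simps)
qed

lemma gain_silent_odds:
  assumes "0 < t" "1 \<le> N"
  shows "gain_silent N (t / (1 + t)) (t / (1 + t)) b c v = ((v - b) * silent_coeff N t + (b - c) * both_coeff N t) / (1 + t)^N"
proof -
  have b: "prob_both N (t / (1 + t)) (t / (1 + t)) = both_coeff N t / (1 + t)^N"
  proof (cases "N = 1")
    case False
    then have "N = 2 + (N - 2)" using assms by simp
    then have p: "(1 + t)^N = (1 + t) * (1 + t) * (1 + t)^(N - 2)" by (metis power_add power2_eq_square)
    have 1: "1 - t / (1 + t) - t / (1 + t) = (1 - t) / (1 + t)" using assms by (simp add: field_simps)
    show ?thesis unfolding prob_both_def 1 p both_coeff_def cond_one_def by (simp add: power_divide)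
  qed (simp add: prob_both_def both_coeff_def cond_one_def)
  have "(1 + t)^N \<noteq> 0" "1 + t \<noteq> 0" using assms by simp_all
  moreover have "silent_coeff N t = 2 * (real N * t) - both_coeff N t" by (simp add: silent_coeff_def both_coeff_def algebra_simps)
  ultimately show ?thesis unfolding gain_silent_def prob_one_odds[OF assms] b
    by (simp add: divide_simps) (simp add: algebra_simps)
qed

lemma one_slot_eq_iff_odds_eq:
  assumes "0 < t" "t \<le> 1" "1 \<le> N"
  shows "one_slot_eq N b c (t / (1 + t)) (t / (1 + t)) v \<longleftrightarrow> odds_eq N b c t v"
proof -
  let ?x = "t / (1 + t)"
  have e: "?x + ?x = 2 * t / (1 + t)" by simp
  have x: "0 < ?x" "?x + ?x \<le> 1" "?x + ?x < 1 \<longleftrightarrow> t < 1"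
    unfolding e using assms by (simp_all add: divide_simps)
  have "(1 + t)^N > 0" using assms by simp
  then show ?thesis
    unfolding one_slot_eq_def odds_eq_def gain_transmit_odds[OF assms(1,3)] gain_silent_odds[OF assms(1,3)]
    using x assms by (auto simp: divide_simps)
qed

lemma one_slot_eq_imp_symmetric:
  assumes inv: "admissible N b c" and eq: "one_slot_eq N b c x y v"
  shows "\<exists>t. 0 < t \<and> t \<le> 1 \<and> x = t / (1 + t) \<and> y = t / (1 + t) \<and> odds_eq N b c t v"
proof -
  have N: "1 \<le> N" and c: "c < b" "0 < b" using inv by (auto simp: admissible_def)
  have pos: "0 < x" "0 < y" using one_slot_eq_pos[OF eq N] .
  have v: "b \<le> v" by (rule latency_monotone[OF inv eq])
  have g: "gain_transmit N x y b v = 1" "gain_transmit N y x b v = 1" "gain_silent N x y b c v \<le> 1" "x + y \<le> 1"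
    using eq pos by (auto simp: one_slot_eq_def)
  have "\<not> y < x"
    using no_asymmetric_equilibrium[of N y x c b v] g pos N c v by auto
  moreover have "\<not> x < y"
    using no_asymmetric_equilibrium[of N x y c b v] g pos N c v by (auto simp: gain_silent_commute[of N y x])
  ultimately have xy: "x = y" by simp
  define t where "t = x / (1 - x)"
  have x: "x \<le> 1/2" using g xy by simp
  then have t: "0 < t" "t \<le> 1" "x = t / (1 + t)" using pos by (auto simp: t_def field_simps)
  then show ?thesis using one_slot_eq_iff_odds_eq[of t N b c v] eq xy N by metis
qed

lemma cond_one_nonneg: "0 \<le> t \<Longrightarrow> t \<le> 1 \<Longrightarrow> 1 \<le> N \<Longrightarrow> 0 \<le> cond_one N t"
  by (simp add: cond_one_def)

text \<open>Given one opponent alone on channel 1, each of the other \<open>N - 1\<close> is on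
  channel 2 with probability \<open>y / (1 - x) = t\<close>. So \<open>cond_one\<close> is the
  conditional probability of exactly one there, and only for a single remaining opponent can it
  exceed 1/2.\<close>

lemma cond_one_le_half:
  assumes "0 \<le> t" "t \<le> 1" "1 \<le> N" "N \<noteq> 2"
  shows "cond_one N t \<le> 1/2"
proof (cases "N = 1")
  case False
  then show ?thesis using times_power_le_half[of "N - 1" t] assms
    by (simp add: cond_one_def of_nat_diff numeral_2_eq_2)
qed (simp add: cond_one_def)

lemma cond_one_le_one:
  assumes "0 \<le> t" "t \<le> 1" "1 \<le> N"
  shows "cond_one N t \<le> 1"
proof (cases "N = 2")
  case False
  then show ?thesis using cond_one_le_half[of t N] assms by simp
qed (use assms in \<open>simp add: cond_one_def\<close>)

lemma both_coeff_nonneg: "0 \<le> t \<Longrightarrow> t \<le> 1 \<Longrightarrow> 1 \<le> N \<Longrightarrow> 0 \<le> both_coeff N t"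
  by (simp add: both_coeff_def cond_one_nonneg)

lemma both_coeff_le:
  assumes "4 \<le> N" "0 \<le> t" "t \<le> 1"
  shows "both_coeff N t \<le> 3/4"
  using square_times_power_le[OF assms] by (simp add: both_coeff_def cond_one_def power2_eq_square mult_ac)

lemma silent_coeff_pos: "0 < t \<Longrightarrow> t \<le> 1 \<Longrightarrow> 1 \<le> N \<Longrightarrow> 0 < silent_coeff N t"
  using cond_one_le_one[of t N] by (simp add: silent_coeff_def)

lemma transmit_coeff_ge_1: "0 \<le> t \<Longrightarrow> t \<le> 1 \<Longrightarrow> 1 \<le> transmit_coeff N t"
  by (simp add: transmit_coeff_def power_le_one)

lemma odds_eq_exists:
  assumes N: "1 \<le> N"
  shows "\<exists>t v. odds_eq N b c t v"
proof -
  \<comment> \<open>For given \<open>t\<close> the transmission equation determines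
    \<open>v\<close>, as \<open>transmit_coeff\<close> is at least 1. The excess in the silence
    inequality is then \<open>G t\<close> divided by \<open>transmit_coeff N t\<close>, so a zero of
    \<open>G\<close> or \<open>G 1 \<le> 0\<close> is wanted.\<close>
  define G where "G = (\<lambda>t. ((1 + t)^N - b) * silent_coeff N t - transmit_coeff N t * ((1 + t)^N - (b - c) * both_coeff N t))"
  have *: "odds_eq N b c t (b + ((1 + t)^N - b) / transmit_coeff N t)"
    if "0 < t" "t \<le> 1" "G t \<le> 0" "t < 1 \<Longrightarrow> G t = 0" for t
  proof -
    have d: "1 \<le> transmit_coeff N t" using that by (intro transmit_coeff_ge_1) auto
    have "((1 + t)^N - b) / transmit_coeff N t * silent_coeff N t + (b - c) * both_coeff N t - (1 + t)^N = G t / transmit_coeff N t"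
      using d by (simp add: G_def field_simps)
    moreover have "G t / transmit_coeff N t \<le> 0" "t < 1 \<Longrightarrow> G t / transmit_coeff N t = 0"
      using that d by (auto simp: divide_nonpos_pos)
    moreover have "((1 + t)^N - b) / transmit_coeff N t * transmit_coeff N t = (1 + t)^N - b" using d by simp
    ultimately show ?thesis unfolding odds_eq_def using that by auto
  qed
  show ?thesis
  proof (cases "G 1 \<le> 0")
    case True
    then show ?thesis using *[of 1] by auto
  next
    case False
    have "G 0 = -1" by (simp add: G_def silent_coeff_def transmit_coeff_def both_coeff_def)
    moreover have "continuous_on {0..1} G"
      unfolding G_def silent_coeff_def transmit_coeff_def both_coeff_def cond_one_def by (intro continuous_intros)
    ultimately obtain t where t: "0 \<le> t" "t \<le> 1" "G t = 0"
      using IVT'[of G 0 0 1] False by auto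
    then have "0 < t" using \<open>G 0 = -1\<close> by (auto simp: less_le)
    then show ?thesis using *[of t] t by auto
  qed
qed

section \<open>Monotonicity of the coefficients and uniqueness of the odds\<close>

lemma both_coeff_decay_bound:
  fixes t :: real
  assumes "1 \<le> k" "0 \<le> t" "t \<le> 1"
  shows "2 * real (k + 2) * t * (1 - t)^k * (real (k + 2) * t - 1) \<le> 3/2"
proof (cases "k = 1")
  case True
  \<comment> \<open>37/50 approximates the local minimum \<open>(4 + sqrt 7) / 9\<close> of the
    cubic, and 11/75 then matches the coefficient of \<open>t^2\<close>.\<close>
  have "0 \<le> 3 * (t - 37/50)^2 * (t + 11/75)" using assms by simp
  also have "\<dots> = 3 * t^3 - 4 * t^2 + 2479/2500 * t + 15059/62500"
    by (simp add: power2_eq_square power3_eq_cube field_simps)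
  finally have "3 * t^3 - 4 * t^2 + t + 1/4 \<ge> 0" using assms by linarith
  then show ?thesis by (simp add: True power2_eq_square power3_eq_cube algebra_simps)
next
  case False
  have "real (k + 2) * t - 1 \<le> real (k + 1) * t" using assms by (simp add: algebra_simps)
  then have "2 * real (k + 2) * t * (1 - t)^k * (real (k + 2) * t - 1)
      \<le> 2 * real (k + 2) * t * (1 - t)^k * (real (k + 1) * t)"
    using assms by (intro mult_left_mono) auto
  also have "\<dots> = 2 * (real (k + 2) * (real (k + 2) - 1) * t^2 * (1 - t)^(k + 2 - 2))"
    by (simp add: power2_eq_square algebra_simps)
  also have "\<dots> \<le> 2 * (3/4)"
    using assms False by (intro mult_left_mono square_times_power_le) auto
  finally show ?thesis by simp
qed

text \<open>The constant 3/2 is the lower bound for \<open>b / (b - c)\<close> in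
  \<open>admissible\<close>. Where \<open>both_coeff\<close> falls, the growth of
  \<open>(1 + t)^N\<close> has to compensate; the sign of the derivative is exactly
  \<open>both_coeff_decay_bound\<close>.\<close>

lemma both_coeff_over_power_antimono:
  assumes N: "4 \<le> N" and t: "0 \<le> s" "s \<le> t" "t \<le> 1"
  shows "(3/2 - both_coeff N t) * (1 + s)^N \<le> (3/2 - both_coeff N s) * (1 + t)^N"
proof -
  obtain k where k: "N = Suc (Suc (Suc k))" "1 \<le> k"
    using N by (intro that[of "N - 3"]) auto
  have "(3/2 - both_coeff N t) / (1 + t)^N \<le> (3/2 - both_coeff N s) / (1 + s)^N"
  proof (rule DERIV_nonpos_imp_nonincreasing[OF t(2)])
    fix z assume z: "s \<le> z" "z \<le> t"
    define W' where "W' = real N * real (k + 2) * z * (1 - z)^k * (2 - real N * z)"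
    have both_coeff: "both_coeff N = (\<lambda>z. real N * real (k + 2) * z^2 * (1 - z)^Suc k)"
      by (rule ext) (simp add: both_coeff_def cond_one_def k power2_eq_square)
    have "(both_coeff N has_real_derivative W') (at z)"
      unfolding both_coeff W'_def
      by (rule derivative_eq_intros refl | simp)+ (simp add: k power2_eq_square algebra_simps)
    then have der: "((\<lambda>z. (3/2 - both_coeff N z) / (1 + z)^N) has_real_derivative
       (- W' * (1 + z)^N - (3/2 - both_coeff N z) * (real N * (1 + z)^(N-1))) / ((1 + z)^N * (1 + z)^N)) (at z)"
      using z t by (auto intro!: derivative_eq_intros)
    have p: "(1 + z)^N = (1 + z) * (1 + z)^(N-1)" by (simp add: k)
    have "- W' * (1 + z) - (3/2 - both_coeff N z) * real N
       = real N * (2 * real (k + 2) * z * (1 - z)^k * (real (k + 2) * z - 1) - 3/2)"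
      unfolding W'_def both_coeff by (simp add: k power2_eq_square algebra_simps)
    also have "\<dots> \<le> 0"
      using both_coeff_decay_bound[of k z] k z t by (intro mult_nonneg_nonpos) auto
    finally have "(- W' * (1 + z) - (3/2 - both_coeff N z) * real N) * (1 + z)^(N-1) \<le> 0"
      using z t by (intro mult_nonpos_nonneg) auto
    then have "- W' * (1 + z)^N - (3/2 - both_coeff N z) * (real N * (1 + z)^(N-1)) \<le> 0"
      unfolding p by (simp add: algebra_simps)
    then have "(- W' * (1 + z)^N - (3/2 - both_coeff N z) * (real N * (1 + z)^(N-1))) / ((1 + z)^N * (1 + z)^N) \<le> 0"
      by (intro divide_nonpos_nonneg) auto
    then show "\<exists>y. ((\<lambda>z. (3/2 - both_coeff N z) / (1 + z)^N) has_real_derivative y) (at z) \<and> y \<le> 0"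
      using der by blast
  qed
  then show ?thesis using t by (simp add: divide_simps mult.commute)
qed

text \<open>Up to the factor \<open>N\<close> this is minus the numerator of the derivative of
  \<open>transmit_coeff / silent_coeff\<close>. The second summand is negative only if
  \<open>\<beta> < 1\<close>; there all quantities are bounded by rational functions of
  \<open>\<beta>\<close>, and a polynomial inequality on the unit interval is left.\<close>

lemma coeff_ratio_derivative_bound:
  fixes t :: real
  assumes k: "1 \<le> k" and t: "0 \<le> t" "t \<le> 1"
    and N: "N = Suc (Suc (Suc k))"
  shows "0 \<le> (2 - cond_one N t) * (1 - both_coeff N t)
    + real (k + 2) * t * (1 - t)^k * (real (k + 2) * t - 1) * transmit_coeff N t"
proof -
  define \<beta> where "\<beta> = real (k + 2) * t"
  have N4: "4 \<le> N" using k N by simp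
  have th1: "cond_one N t \<le> 1" "0 \<le> cond_one N t" using cond_one_le_one[of t N] cond_one_nonneg[of t N] t N by auto
  have ww1: "both_coeff N t \<le> 3/4" using both_coeff_le[OF N4 t] .
  have dd1: "1 \<le> transmit_coeff N t" using transmit_coeff_ge_1 t by simp
  have thb: "cond_one N t = \<beta> * (1 - t)^Suc k" by (simp add: cond_one_def N \<beta>_def)
  have b0: "0 \<le> \<beta>" using t by (simp add: \<beta>_def)
  show ?thesis
  proof (cases "1 \<le> \<beta>")
    case True
    then show ?thesis using th1 ww1 dd1 t unfolding \<beta>_def
      by (intro add_nonneg_nonneg mult_nonneg_nonneg) auto
  next
    case False
    have Nt: "real N * t \<le> 4/3 * \<beta>"
    proof -
      have "real N \<le> 4/3 * real (k + 2)" using k by (simp add: N)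
      then have "real N * t \<le> 4/3 * real (k + 2) * t" using t by (intro mult_right_mono) auto
      then show ?thesis by (simp add: \<beta>_def algebra_simps)
    qed
    have "1 + real (k + 2) * (- t) \<le> (1 + (- t))^(k + 2)"
      using t by (intro Bernoulli_inequality) auto
    then have q: "1 - (1 - t)^(N - 1) \<le> \<beta>" "0 \<le> 1 - (1 - t)^(N - 1)"
      using t power_le_one[of "1 - t" "N - 1"] by (auto simp: \<beta>_def N)
    have "transmit_coeff N t \<le> 1 + 4/3 * \<beta> * \<beta>"
      unfolding transmit_coeff_def using mult_mono[OF Nt q(1)] b0 q(2) by simp
    also have "\<beta> * \<beta> \<le> 1" using False b0 by (simp add: mult_le_one)
    then have "1 + 4/3 * \<beta> * \<beta> \<le> 7/3" by simp
    finally have transmit_coeff: "transmit_coeff N t \<le> 7/3" .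
    have "\<beta> * (1 - t)^k \<le> \<beta> * 1" using b0 t by (intro mult_left_mono power_le_one) auto
    then have "\<beta> * (1 - t)^k * (1 - \<beta>) * transmit_coeff N t \<le> \<beta> * (1 - \<beta>) * (7/3)"
      using transmit_coeff b0 False dd1 by (intro mult_mono) auto
    moreover have "\<beta> * (1 - \<beta>) * (7/3) \<le> (2 - cond_one N t) * (1 - both_coeff N t)"
    proof -
      \<comment> \<open>Bernoulli's inequality for \<open>1 + t\<close> and the product
        \<open>1 - t^2\<close> bound the power of \<open>1 - t\<close> by a reciprocal of a linear
        function, hence \<open>cond_one\<close> by
        \<open>3 * \<beta> / (3 + 2 * \<beta>)\<close>.\<close>
      have "(1 - t)^Suc k * (1 + real (Suc k) * t) \<le> (1 - t)^Suc k * (1 + t)^Suc k"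
        using t Bernoulli_inequality[of t "Suc k"] by (intro mult_left_mono) auto
      also have "\<dots> = (1 - t^2)^Suc k"
        by (simp only: power_mult_distrib[symmetric]) (simp add: power2_eq_square algebra_simps)
      also have "\<dots> \<le> 1" using t by (intro power_le_one) (auto simp: power_le_one)
      finally have 1: "(1 - t)^Suc k * (1 + real (Suc k) * t) \<le> 1" .
      have "2/3 * \<beta> \<le> real (Suc k) * t"
      proof -
        have "2/3 * real (k + 2) \<le> real (Suc k)" using k by simp
        then have "2/3 * real (k + 2) * t \<le> real (Suc k) * t" using t by (intro mult_right_mono) auto
        then show ?thesis by (simp add: \<beta>_def algebra_simps)
      qed
      then have "(1 - t)^Suc k * (1 + 2/3 * \<beta>) \<le> (1 - t)^Suc k * (1 + real (Suc k) * t)"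
        using t by (intro mult_left_mono) auto
      then have "(1 - t)^Suc k * (1 + 2/3 * \<beta>) \<le> 1" using 1 by linarith
      then have "\<beta> * ((1 - t)^Suc k * (1 + 2/3 * \<beta>)) \<le> \<beta> * 1" using b0 by (intro mult_left_mono) auto
      then have thl: "cond_one N t * (3 + 2 * \<beta>) \<le> 3 * \<beta>" unfolding thb by (simp add: algebra_simps)
      have a: "(6 + \<beta>) / (3 + 2 * \<beta>) \<le> 2 - cond_one N t" using thl b0 by (simp add: field_simps)
      have "both_coeff N t \<le> 4/3 * \<beta> * cond_one N t" unfolding both_coeff_def using Nt th1 by (intro mult_right_mono) auto
      then have "both_coeff N t * (3 + 2 * \<beta>) \<le> 4/3 * \<beta> * cond_one N t * (3 + 2 * \<beta>)"
        using b0 by (intro mult_right_mono) auto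
      also have "\<dots> = 4/3 * \<beta> * (cond_one N t * (3 + 2 * \<beta>))" by simp
      also have "\<dots> \<le> 4/3 * \<beta> * (3 * \<beta>)" using thl b0 by (intro mult_left_mono) auto
      finally have b: "(3 + 2 * \<beta> - 4 * \<beta>^2) / (3 + 2 * \<beta>) \<le> 1 - both_coeff N t"
        using b0 by (simp add: field_simps power2_eq_square)
      have bb: "\<beta>^2 \<le> \<beta>" using b0 False by (simp add: power2_eq_square mult_left_le_one_le)
      have "(6 + \<beta>) / (3 + 2 * \<beta>) * ((3 + 2 * \<beta> - 4 * \<beta>^2) / (3 + 2 * \<beta>)) \<le> (2 - cond_one N t) * (1 - both_coeff N t)"
        using a b b0 bb False th1 by (intro mult_mono) (auto intro!: divide_nonneg_nonneg)
      moreover have "\<beta> * (1 - \<beta>) * (7/3) \<le> (6 + \<beta>) * (3 + 2 * \<beta> - 4 * \<beta>^2) / (3 + 2 * \<beta>)^2"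
      proof -
        have "(3 + 2 * \<beta>)^2 \<le> 5^2" using b0 False by (intro power_mono) auto
        then have "\<beta> * (1 - \<beta>) * (7/3) * (3 + 2 * \<beta>)^2 \<le> \<beta> * (1 - \<beta>) * (7/3) * 25"
          using b0 False by (intro mult_left_mono) auto
        also have "\<dots> \<le> (6 + \<beta>) * (3 + 2 * \<beta> - 4 * \<beta>^2)"
        proof -
          \<comment> \<open>The quadratic below has its vertex at 65/97, close to 2/3.\<close>
          have "0 \<le> (\<beta> - 2/3)^2" by simp
          then have "0 \<le> 18 - 130/3 * \<beta> + 97/3 * \<beta>^2"
            by (simp add: power2_eq_square field_simps) (use b0 False in linarith)
          moreover have "\<beta>^3 \<le> \<beta>^2" using b0 False by (intro power_decreasing) auto
          moreover have "\<beta> * (1 - \<beta>) * (7/3) * 25 = 175/3 * \<beta> - 175/3 * \<beta>^2"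
            by (simp add: power2_eq_square field_simps)
          moreover have "(6 + \<beta>) * (3 + 2 * \<beta> - 4 * \<beta>^2) = 18 + 15 * \<beta> - 22 * \<beta>^2 - 4 * \<beta>^3"
            by (simp add: power2_eq_square power3_eq_cube algebra_simps)
          ultimately show ?thesis by linarith
        qed
        finally show ?thesis using b0 by (simp add: pos_le_divide_eq)
      qed
      moreover have eq: "(6 + \<beta>) / (3 + 2 * \<beta>) * ((3 + 2 * \<beta> - 4 * \<beta>^2) / (3 + 2 * \<beta>))
          = (6 + \<beta>) * (3 + 2 * \<beta> - 4 * \<beta>^2) / (3 + 2 * \<beta>)^2"
        by (simp add: power2_eq_square)
      ultimately show ?thesis by linarith
    qed
    moreover have "\<beta> * (1 - t)^k * (\<beta> - 1) * transmit_coeff N t = - (\<beta> * (1 - t)^k * (1 - \<beta>) * transmit_coeff N t)"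
      by (simp add: algebra_simps)
    ultimately show ?thesis unfolding \<beta>_def[symmetric] by linarith
  qed
qed

lemma coeff_ratio_antimono:
  assumes N: "4 \<le> N" and t: "0 < s" "s \<le> t" "t \<le> 1"
  shows "transmit_coeff N t * silent_coeff N s \<le> transmit_coeff N s * silent_coeff N t"
proof -
  obtain k where k: "N = Suc (Suc (Suc k))" "1 \<le> k"
    using N by (intro that[of "N - 3"]) auto
  have l: "0 < silent_coeff N z" if "s \<le> z" "z \<le> t" for z using silent_coeff_pos[of z N] that t N by simp
  have "transmit_coeff N t / silent_coeff N t \<le> transmit_coeff N s / silent_coeff N s"
  proof (rule DERIV_nonpos_imp_nonincreasing[OF t(2)])
    fix z assume z: "s \<le> z" "z \<le> t"
    define d' where "d' = real N * (1 - (1 - z)^(N-1) + cond_one N z)"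
    define h' where "h' = real (k + 2) * (1 - z)^k * (1 - real (k + 2) * z)"
    define l' where "l' = real N * (2 - cond_one N z) - real N * z * h'"
    have thf: "cond_one N = (\<lambda>z. real (k + 2) * z * (1 - z)^Suc k)"
      by (rule ext) (simp add: cond_one_def k)
    have dh: "(cond_one N has_real_derivative h') (at z)"
      unfolding thf h'_def by (rule derivative_eq_intros refl | simp)+ (simp add: algebra_simps)
    have dl: "(silent_coeff N has_real_derivative l') (at z)"
      unfolding silent_coeff_def[abs_def] l'_def by (rule derivative_eq_intros dh refl | simp)+
    have ddf: "transmit_coeff N = (\<lambda>z. 1 + real N * z * (1 - (1 - z)^Suc (Suc k)))"
      by (rule ext) (simp add: transmit_coeff_def k)
    have ddv: "(transmit_coeff N has_real_derivative d') (at z)"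
      unfolding ddf d'_def thf by (rule derivative_eq_intros refl | simp)+ (simp add: k algebra_simps)
    have der: "((\<lambda>z. transmit_coeff N z / silent_coeff N z) has_real_derivative (d' * silent_coeff N z - transmit_coeff N z * l') / (silent_coeff N z * silent_coeff N z)) (at z)"
      using DERIV_divide[OF ddv dl] l[OF z] by simp
    have "transmit_coeff N z * l' - d' * silent_coeff N z = real N * ((2 - cond_one N z) * (1 - both_coeff N z)
        + real (k + 2) * z * (1 - z)^k * (real (k + 2) * z - 1) * transmit_coeff N z)"
    proof -
      have "z * h' = - (real (k + 2) * z * (1 - z)^k * (real (k + 2) * z - 1))"
        by (simp add: h'_def algebra_simps)
      moreover have "transmit_coeff N z * l' - d' * silent_coeff N z = real N * ((2 - cond_one N z) * (1 - both_coeff N z) - (z * h') * transmit_coeff N z)"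
        unfolding l'_def d'_def silent_coeff_def both_coeff_def transmit_coeff_def by (simp add: algebra_simps)
      ultimately show ?thesis by simp
    qed
    moreover have "0 \<le> \<dots>"
      using coeff_ratio_derivative_bound[OF k(2) _ _ k(1), of z] z t by (intro mult_nonneg_nonneg) auto
    ultimately have "(d' * silent_coeff N z - transmit_coeff N z * l') / (silent_coeff N z * silent_coeff N z) \<le> 0"
      using l[OF z] by (intro divide_nonpos_pos) auto
    then show "\<exists>y. ((\<lambda>z. transmit_coeff N z / silent_coeff N z) has_real_derivative y) (at z) \<and> y \<le> 0"
      using der by blast
  qed
  then show ?thesis using l[of s] l[of t] t by (simp add: divide_simps mult.commute)
qed

lemma odds_eq_ge:
  assumes "admissible N b c" "odds_eq N b c t v"
  shows "b \<le> v"
proof (rule latency_monotone)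
  show "one_slot_eq N b c (t / (1 + t)) (t / (1 + t)) v"
    using assms one_slot_eq_iff_odds_eq[of t N b c v] by (auto simp: odds_eq_def admissible_def)
qed (rule assms)

text \<open>With the explicit values of \<open>b\<close> and \<open>c\<close>, eliminating
  \<open>v\<close> leaves a polynomial in \<open>t\<close> without zeros strictly between 0 and 1,
  so silence is never played against at most three opponents.\<close>

lemma odds_eq_small:
  assumes inv: "admissible N b c" and eq: "odds_eq N b c t v" and N: "N \<le> 3"
  shows "t = 1"
proof (rule ccontr)
  assume "t \<noteq> 1"
  then have t: "0 < t" "t < 1" using eq by (auto simp: odds_eq_def)
  define d where "d = v - b"
  have e: "b + d * transmit_coeff N t = (1 + t)^N" "d * silent_coeff N t + (b - c) * both_coeff N t = (1 + t)^N"
    using eq t by (auto simp: odds_eq_def d_def)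
  have G: "((1 + t)^N - b) * silent_coeff N t = transmit_coeff N t * ((1 + t)^N - (b - c) * both_coeff N t)"
  proof -
    have "(1 + t)^N - b = d * transmit_coeff N t" "(1 + t)^N - (b - c) * both_coeff N t = d * silent_coeff N t"
      using e by linarith+
    then show ?thesis by (simp only: mult_ac)
  qed
  consider "N = 1" | "N = 2" | "N = 3" using N inv by (fastforce simp: admissible_def)
  then show False
  proof cases
    case 1
    then have "b = 1" "c = 0" using inv by (auto simp: admissible_def)
    then have "t * (2 * t) = 1 + t" using G by (simp add: 1 silent_coeff_def transmit_coeff_def both_coeff_def cond_one_def algebra_simps)
    then have "(2 * t + 1) * (t - 1) = 0" by (simp add: algebra_simps)
    then show False using t by auto
  next
    case 2
    then have "b = 2" "c = 1" using inv by (auto simp: admissible_def)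
    then have "4 * t^3 - 9 * t^2 + 6 * t + 1 = 0"
      using G by (simp add: 2 silent_coeff_def transmit_coeff_def both_coeff_def cond_one_def power2_eq_square power3_eq_cube algebra_simps)
    moreover have "4 * t^3 - 9 * t^2 + 6 * t + 1 = t * (4 * (t - 9/8)^2 + 15/16) + 1"
      by (simp add: power2_eq_square power3_eq_cube field_simps)
    moreover have "0 \<le> t * (4 * (t - 9/8)^2 + 15/16)" using t by simp
    ultimately show False by linarith
  next
    case 3
    then have b: "b = 8/3" and c: "c = 2" using inv by (auto simp: admissible_def)
    have "(t - 1) * (21 * t^5 + 21 * t^3 - 9 * t^2 + 14 * t + 1) = 0"
      using G unfolding b c by (simp add: 3 silent_coeff_def transmit_coeff_def both_coeff_def cond_one_def eval_nat_numeral field_simps)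
    then have "21 * t^5 + 21 * t^3 - 9 * t^2 + 14 * t + 1 = 0" using t by simp
    moreover have "t^2 \<le> t" using t by (simp add: power2_eq_square mult_left_le_one_le)
    moreover have "0 \<le> t^5" "0 \<le> t^3" using t by auto
    ultimately show False using t by linarith
  qed
qed

text \<open>At \<open>t = 1\<close> the transmission equation is linear in \<open>v\<close>; this is
  the origin of the explicit numbers in \<open>admissible\<close>.\<close>

lemma odds_eq_small_value:
  assumes inv: "admissible N b c" and eq: "odds_eq N b c t v"
  shows "N = 1 \<Longrightarrow> v = 2" "N = 2 \<Longrightarrow> v = 8/3" "N = 3 \<Longrightarrow> v = 4"
  using odds_eq_small[OF inv eq] inv eq by (auto simp: odds_eq_def transmit_coeff_def admissible_def)

text \<open>With \<open>E = (1 + t)^N\<close> and \<open>w = (b - c) * both_coeff N t\<close>, eliminating \<open>v\<close> gives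
  \<open>(E - b) / (E - w) = transmit_coeff N t / silent_coeff N t\<close>, whose left side is strictly increasing.\<close>

lemma odds_eq_not_less:
  assumes inv: "admissible N b c" and N: "4 \<le> N"
    and eq1: "odds_eq N b c s u" and eq2: "odds_eq N b c t v"
  shows "\<not> s < t"
proof
  assume st: "s < t"
  have s: "0 < s" "s < 1" and t: "0 < t" "t \<le> 1" using st eq1 eq2 by (auto simp: odds_eq_def)
  define E1 E2 where "E1 = (1 + s)^N" and "E2 = (1 + t)^N"
  define w1 w2 where "w1 = (b - c) * both_coeff N s" and "w2 = (b - c) * both_coeff N t"
  have b: "0 < b" "0 \<le> b - c" "3 * (b - c) \<le> 2 * b" using inv N by (auto simp: admissible_def)
  have d1: "1 \<le> transmit_coeff N s" and d2: "1 \<le> transmit_coeff N t" using s t by (auto intro!: transmit_coeff_ge_1)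
  have l1: "0 < silent_coeff N s" and l2: "0 < silent_coeff N t" using s t N by (auto intro!: silent_coeff_pos)
  have e1: "E1 - b = (u - b) * transmit_coeff N s" "E1 - w1 = (u - b) * silent_coeff N s"
    and e2: "E2 - b = (v - b) * transmit_coeff N t" "E2 - w2 \<ge> (v - b) * silent_coeff N t"
    using eq1 eq2 s by (auto simp: odds_eq_def E1_def E2_def w1_def w2_def)
  have u: "b \<le> u" and v: "b \<le> v" using odds_eq_ge[OF inv] eq1 eq2 by auto
  have E1: "b \<le> E1" using e1(1) u d1 by (metis diff_ge_0_iff_ge mult_nonneg_nonneg order_trans zero_le_one)
  have E12: "E1 < E2" unfolding E1_def E2_def using st s N by (intro power_strict_mono) auto
  have W: "both_coeff N s \<le> 3/4" "both_coeff N t \<le> 3/4" using both_coeff_le N s t by auto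
  have "w1 \<le> (b - c) * (3/4)" unfolding w1_def using W b by (intro mult_left_mono) auto
  then have bw: "w1 < b" using b by linarith
  have "(E1 - b) * (E2 - w2) < (E2 - b) * (E1 - w1)"
  proof -
    have eq: "(E2 - b) * (E1 - w1) - (E1 - b) * (E2 - w2) = (b - w1) * (E2 - E1) - (w1 - w2) * (E1 - b)"
      by (simp add: algebra_simps)
    have pos: "0 < (b - w1) * (E2 - E1)" using bw E12 by simp
    have "(w1 - w2) * (E1 - b) < (b - w1) * (E2 - E1)"
    proof (cases "w1 \<le> w2")
      case True
      then have "(w1 - w2) * (E1 - b) \<le> 0" using E1 by (intro mult_nonpos_nonneg) auto
      then show ?thesis using pos by linarith
    next
      case False
      \<comment> \<open>This is the only dangerous case: \<open>w\<close> falls from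
        \<open>s\<close> to \<open>t\<close>, and the fall must be outweighed by the growth of
        \<open>E\<close>. Strictness comes from \<open>(w1 - w2) * b\<close>.\<close>
      have "(3/2 - both_coeff N t) * E1 \<le> (3/2 - both_coeff N s) * E2"
        unfolding E1_def E2_def using both_coeff_over_power_antimono[of N s t] N s t st by simp
      moreover have "(3/2 - both_coeff N s) * (E2 - E1) - (both_coeff N s - both_coeff N t) * E1
          = (3/2 - both_coeff N s) * E2 - (3/2 - both_coeff N t) * E1" by (simp add: field_simps)
      ultimately have "(both_coeff N s - both_coeff N t) * E1 \<le> (3/2 - both_coeff N s) * (E2 - E1)" by linarith
      then have "(b - c) * ((both_coeff N s - both_coeff N t) * E1) \<le> (b - c) * ((3/2 - both_coeff N s) * (E2 - E1))"
        using b by (intro mult_left_mono) auto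
      also have "\<dots> = (3/2 * (b - c) - w1) * (E2 - E1)" by (simp add: w1_def algebra_simps)
      also have "\<dots> \<le> (b - w1) * (E2 - E1)" using b E12 by (intro mult_right_mono) auto
      also have "(b - c) * ((both_coeff N s - both_coeff N t) * E1) = (w1 - w2) * E1"
        by (simp add: w1_def w2_def algebra_simps)
      finally have "(w1 - w2) * E1 \<le> (b - w1) * (E2 - E1)" .
      moreover have "0 < (w1 - w2) * b" using False b by simp
      ultimately show ?thesis by (simp add: algebra_simps)
    qed
    then show ?thesis using eq by linarith
  qed
  then have "(u - b) * transmit_coeff N s * (E2 - w2) < (v - b) * transmit_coeff N t * ((u - b) * silent_coeff N s)"
    unfolding e1 e2(1) .
  also have "\<dots> = (u - b) * (v - b) * (transmit_coeff N t * silent_coeff N s)" by simp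
  also have "\<dots> \<le> (u - b) * (v - b) * (transmit_coeff N s * silent_coeff N t)"
    using u v coeff_ratio_antimono[OF N s(1), of t] st t by (intro mult_left_mono) auto
  also have "\<dots> = (u - b) * transmit_coeff N s * ((v - b) * silent_coeff N t)" by simp
  also have "\<dots> \<le> (u - b) * transmit_coeff N s * (E2 - w2)"
    using e2(2) u d1 by (intro mult_left_mono) auto
  finally show False by simp
qed

lemma odds_eq_unique:
  assumes inv: "admissible N b c" and eq1: "odds_eq N b c s u" and eq2: "odds_eq N b c t v"
  shows "s = t" "u = v"
proof -
  show st: "s = t"
  proof (cases "N \<le> 3")
    case True
    then show ?thesis using odds_eq_small[OF inv] eq1 eq2 by blast
  next
    case False
    then show ?thesis using odds_eq_not_less[OF inv _ eq1 eq2] odds_eq_not_less[OF inv _ eq2 eq1] by linarith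
  qed
  have "1 \<le> transmit_coeff N t" using eq2 by (intro transmit_coeff_ge_1) (auto simp: odds_eq_def)
  moreover have "b + (u - b) * transmit_coeff N t = b + (v - b) * transmit_coeff N t"
    using eq1[unfolded st] eq2 unfolding odds_eq_def by metis
  ultimately show "u = v" by simp
qed

section \<open>Growth caused by one additional player\<close>

lemma power_times_linear_le_quarter:
  fixes t :: real
  assumes n: "2 \<le> n" and t: "0 \<le> t" "t \<le> 1"
  shows "(1 - t)^n * (real (n + 2) * t - 1) \<le> 1/4"
proof (cases "real (n + 2) * t - 1 \<le> 0 \<or> t = 1")
  case True
  then show ?thesis
  proof
    assume "real (n + 2) * t - 1 \<le> 0"
    then have "(1 - t)^n * (real (n + 2) * t - 1) \<le> 0" using t by (intro mult_nonneg_nonpos) auto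
    then show ?thesis by simp
  qed (use n in \<open>simp add: power_0_left\<close>)
next
  case False
  then have p: "0 < real (n + 2) * t - 1" and t1: "0 < 1 - t" using t by auto
  \<comment> \<open>The left side is largest at \<open>t = 2 / (n + 2)\<close>, with value
    \<open>1 / (1 + 2 / n)^n \<le> 1/4\<close>. At this point \<open>y = 1\<close>, so Bernoulli's
    inequality for \<open>y\<close> loses nothing there and replaces a derivative.\<close>
  define z0 where "z0 = 2 / real n"
  define y where "y = 1 / ((1 - t) * (1 + z0))"
  have z0: "0 < z0" "real n * z0 = 2" using n by (auto simp: z0_def)
  have c: "4 \<le> (1 + z0)^n"
    using binomial_ge_twice_linear_term[of 1 z0 n] n z0 by simp
  have "1 + real (n + 1) * (y - 1) \<le> (1 + (y - 1))^(n + 1)"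
    using t1 z0 by (intro Bernoulli_inequality) (simp add: y_def)
  then have "1 + real (n + 1) * (y - 1) \<le> y^(n + 1)" by simp
  then have "(1 + real (n + 1) * (y - 1)) * ((1 - t) * (1 + z0))^(n + 1) \<le> y^(n + 1) * ((1 - t) * (1 + z0))^(n + 1)"
    using t1 z0 by (intro mult_right_mono) auto
  also have "\<dots> = 1" using t1 z0 by (simp add: y_def power_divide)
  finally have 1: "(1 + real (n + 1) * (y - 1)) * ((1 - t) * (1 + z0))^(n + 1) \<le> 1" .
  have 2: "(1 + real (n + 1) * (y - 1)) * ((1 - t) * (1 + z0)) = real (n + 2) * t - 1"
  proof -
    have "y * ((1 - t) * (1 + z0)) = 1" using t1 z0 by (simp add: y_def)
    moreover have "(1 + real (n + 1) * (y - 1)) * x = real (n + 1) * (y * x) - real n * x" for x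
      by (simp add: algebra_simps)
    ultimately have "(1 + real (n + 1) * (y - 1)) * ((1 - t) * (1 + z0)) = real (n + 1) - real n * ((1 - t) * (1 + z0))"
      by simp
    also have "\<dots> = real (n + 1) - (1 - t) * (real n + real n * z0)" by (simp add: algebra_simps)
    finally show ?thesis unfolding z0(2) by (simp add: algebra_simps)
  qed
  have "(1 + real (n + 1) * (y - 1)) * ((1 - t) * (1 + z0))^(n + 1)
      = ((1 + real (n + 1) * (y - 1)) * ((1 - t) * (1 + z0))) * ((1 - t) * (1 + z0))^n" by simp
  then have "(real (n + 2) * t - 1) * ((1 - t)^n * (1 + z0)^n) \<le> 1"
    using 1 unfolding 2 by (simp only: power_mult_distrib)
  moreover have "(real (n + 2) * t - 1) * ((1 - t)^n * 4) \<le> (real (n + 2) * t - 1) * ((1 - t)^n * (1 + z0)^n)"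
    using p t1 c by (intro mult_left_mono) auto
  ultimately show ?thesis by (simp add: mult_ac)
qed

lemma silent_coeff_minus_transmit_coeff:
  assumes "4 \<le> N" "0 \<le> t" "t \<le> 1"
  shows "real N * t * (3/4) - 1 \<le> silent_coeff N t - transmit_coeff N t"
proof -
  obtain n where n: "N = n + 2" "2 \<le> n" using assms by (intro that[of "N - 2"]) auto
  have "cond_one N t - (1 - t)^(N-1) = (1 - t)^n * (real (n + 2) * t - 1)"
    by (simp add: cond_one_def n algebra_simps)
  then have "cond_one N t - (1 - t)^(N-1) \<le> 1/4" using power_times_linear_le_quarter[OF n(2)] assms by simp
  then have "real N * t * (3/4) \<le> real N * t * (1 - (cond_one N t - (1 - t)^(N-1)))"
    using assms by (intro mult_left_mono) auto
  then show ?thesis by (simp add: silent_coeff_def transmit_coeff_def algebra_simps)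
qed

lemma power_le_exp:
  assumes "0 \<le> (t::real)"
  shows "(1 + t)^N \<le> exp (real N * t)"
proof -
  have "(1 + t)^N \<le> exp t^N" using assms by (intro power_mono exp_ge_add_one_self) auto
  then show ?thesis by (simp add: exp_of_nat_mult)
qed

text \<open>The starting point is that \<open>silent_coeff\<close> lies between
  \<open>3/2 * a\<close> and \<open>2 * a\<close>. The estimate \<open>E \<le> 16 * b\<close>
  complements \<open>b \<le> E\<close>, so that \<open>b\<close> alone fixes the order of
  \<open>E\<close>; the last conclusion is the clause of \<open>admissible\<close> needed one player
  later.\<close>

lemma odds_eq_growth:
  assumes inv: "admissible N b c" and N: "4 \<le> N" and eq: "odds_eq N b c t v"
  defines "a \<equiv> real N * t" and "E \<equiv> (1 + t)^N"
  shows "(v - b) * (3/2 * a) \<le> E" "E \<le> 4 * a * (v - b)" "b \<le> E" "v \<le> E"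
    "2 \<le> a \<Longrightarrow> E \<le> 16 * b" "3 * (v - b) \<le> 2 * v"
proof -
  have t: "0 < t" "t \<le> 1" using eq by (auto simp: odds_eq_def)
  have b: "4 \<le> b" "0 \<le> b - c" "3 * (b - c) \<le> 2 * b" "b \<le> 2^(N-1)" using inv N by (auto simp: admissible_def)
  have v: "b \<le> v" by (rule odds_eq_ge[OF inv eq])
  have d: "1 \<le> transmit_coeff N t" using t by (intro transmit_coeff_ge_1) auto
  have e1: "b + (v - b) * transmit_coeff N t = E" and e2: "(v - b) * silent_coeff N t + (b - c) * both_coeff N t \<le> E"
    using eq by (auto simp: odds_eq_def E_def)
  have w: "0 \<le> (b - c) * both_coeff N t" using b both_coeff_nonneg[of t N] t N by simp
  have thb: "0 \<le> cond_one N t" "cond_one N t \<le> 1/2" using cond_one_le_half[of t N] cond_one_nonneg[of t N] t N by auto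
  have a0: "0 < a" using t N by (simp add: a_def)
  have l: "3/2 * a \<le> silent_coeff N t" "silent_coeff N t \<le> 2 * a"
  proof -
    have "a * (3/2) \<le> a * (2 - cond_one N t)" "a * (2 - cond_one N t) \<le> a * 2"
      using a0 thb by (auto intro!: mult_left_mono)
    then show "3/2 * a \<le> silent_coeff N t" "silent_coeff N t \<le> 2 * a" by (auto simp: silent_coeff_def a_def)
  qed
  show "(v - b) * (3/2 * a) \<le> E"
    using mult_left_mono[OF l(1), of "v - b"] v e2 w by linarith
  have "v - b \<le> (v - b) * transmit_coeff N t" using mult_left_mono[OF d, of "v - b"] v by simp
  then show "v \<le> E" using e1 by linarith
  then show bE: "b \<le> E" using v by linarith
  show lower: "E \<le> 4 * a * (v - b)"
  proof (cases "t = 1")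
    case True
    have "transmit_coeff N t \<le> 2 * real N" using N True by (simp add: transmit_coeff_def power_0_left)
    then have "(v - b) * transmit_coeff N t \<le> (v - b) * (2 * real N)" using v by (intro mult_left_mono) auto
    \<comment> \<open>Here \<open>E = 2^N\<close>, so \<open>b \<le> 2^(N-1)\<close> leaves at least
      half of \<open>E\<close> to the term with \<open>v - b\<close>.\<close>
    moreover have "2 * b \<le> E"
      using b(4) N by (simp add: E_def True) (cases N, auto)
    ultimately show ?thesis using e1 True by (simp add: a_def algebra_simps)
  next
    case False
    then have "(v - b) * silent_coeff N t + (b - c) * both_coeff N t = E" using eq t by (auto simp: odds_eq_def E_def)
    moreover have "(b - c) * both_coeff N t \<le> (b - c) * (3/4)"
      using b both_coeff_le[OF N, of t] t by (intro mult_left_mono) auto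
    moreover have "(v - b) * silent_coeff N t \<le> (v - b) * (2 * a)" using l v by (intro mult_left_mono) auto
    ultimately show ?thesis using b bE by (simp add: algebra_simps)
  qed
  \<comment> \<open>Subtracting the transmission equation from the silence inequality cancels
    \<open>E\<close>, so \<open>v - b\<close> is compared with \<open>b\<close> directly.\<close>
  have gap: "(v - b) * (a * (3/4) - 1) \<le> b"
  proof -
    have "(v - b) * (a * (3/4) - 1) \<le> (v - b) * (silent_coeff N t - transmit_coeff N t)"
      using silent_coeff_minus_transmit_coeff[OF N, of t] t v unfolding a_def by (intro mult_left_mono) auto
    then show ?thesis using e1 e2 w unfolding right_diff_distrib[of "v - b" "silent_coeff N t"] by linarith
  qed
  show "E \<le> 16 * b" if "2 \<le> a"
  proof -
    have "(v - b) * (a / 4) \<le> (v - b) * (a * (3/4) - 1)" using that v by (intro mult_left_mono) auto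
    moreover have "4 * a * (v - b) = 16 * ((v - b) * (a / 4))" by simp
    ultimately show ?thesis using gap lower by linarith
  qed
  show "3 * (v - b) \<le> 2 * v"
  proof (cases "2 \<le> a")
    case True
    then have "(v - b) * (1/2) \<le> (v - b) * (a * (3/4) - 1)" using v by (intro mult_left_mono) auto
    then have "(v - b) * (1/2) \<le> b" using gap by (rule order_trans)
    then show ?thesis by simp
  next
    case False
    \<comment> \<open>For small \<open>a\<close> the estimate \<open>gap\<close> says little, but
      then \<open>v \<le> exp 2 \<le> 9\<close>, while \<open>4 \<le> b\<close>.\<close>
    have "E \<le> exp a" unfolding E_def a_def using t by (intro power_le_exp) auto
    also have "\<dots> \<le> exp 2" using False by simp
    also have "exp 2 = exp 1 * exp (1::real)" by (simp flip: exp_add)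
    also have "\<dots> \<le> 3 * 3" using exp_le by (intro mult_mono) auto
    finally have "v \<le> 9" using \<open>v \<le> E\<close> by simp
    then show ?thesis using b(1) by (simp add: algebra_simps)
  qed
qed

lemma admissible_step:
  assumes inv: "admissible N b c" and eq: "odds_eq N b c t v"
  shows "admissible (Suc N) v b"
proof -
  have t: "0 < t" "t \<le> 1" using eq by (auto simp: odds_eq_def)
  have i: "1 \<le> N" "0 \<le> c" "c < b" using inv by (auto simp: admissible_def)
  consider "N = 1" | "N = 2" | "N = 3" | "4 \<le> N" using i by linarith
  then show ?thesis
  proof cases
    case 4
    note g = odds_eq_growth[OF inv 4 eq]
    have b4: "4 \<le> b" using inv 4 by (simp add: admissible_def)
    have "0 < 4 * (real N * t) * (v - b)" using g(2,3) b4 by linarith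
    then have "b < v" using odds_eq_ge[OF inv eq] by (cases "v = b") auto
    moreover have "(1 + t)^N \<le> 2^N" using t by (intro power_mono) auto
    ultimately show ?thesis using g(4,6) b4 4 by (auto simp: admissible_def)
  qed (use odds_eq_small_value[OF inv eq] inv in \<open>auto simp: admissible_def\<close>)
qed

section \<open>Asymptotics of the equilibrium latencies\<close>

text \<open>The choice is harmless: a solution exists for all \<open>b\<close> and \<open>c\<close>
  once \<open>N \<ge> 1\<close>, so the recursion can be written down before admissibility is known,
  and admissibility later makes the solution unique.\<close>

definition next_latency :: "nat \<Rightarrow> real \<Rightarrow> real \<Rightarrow> real" where
  "next_latency N b c = (SOME v. \<exists>t. odds_eq N b c t v)"

fun eq_latency :: "nat \<Rightarrow> real" where
  "eq_latency 0 = 0"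
| "eq_latency (Suc 0) = 1"
| "eq_latency (Suc (Suc m)) = next_latency (Suc m) (eq_latency (Suc m)) (eq_latency m)"

definition eq_odds :: "nat \<Rightarrow> real" where
  "eq_odds m = (SOME t. odds_eq (m - 1) (eq_latency (m - 1)) (eq_latency (m - 2)) t (eq_latency m))"

lemma odds_eq_equilibrium:
  assumes "2 \<le> m"
  shows "odds_eq (m - 1) (eq_latency (m - 1)) (eq_latency (m - 2)) (eq_odds m) (eq_latency m)"
proof -
  obtain k where k: "m = Suc (Suc k)" using assms by (intro that[of "m - 2"]) auto
  have "\<exists>v t. odds_eq (Suc k) (eq_latency (Suc k)) (eq_latency k) t v" using odds_eq_exists[of "Suc k" "eq_latency (Suc k)" "eq_latency k"] by auto
  then have "\<exists>t. odds_eq (Suc k) (eq_latency (Suc k)) (eq_latency k) t (eq_latency m)"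
    unfolding k eq_latency.simps next_latency_def by (rule someI_ex)
  then have "\<exists>t. odds_eq (m - 1) (eq_latency (m - 1)) (eq_latency (m - 2)) t (eq_latency m)" by (simp add: k)
  then show ?thesis unfolding eq_odds_def by (rule someI_ex)
qed

lemma admissible_eq_latency: "admissible (Suc m) (eq_latency (Suc m)) (eq_latency m)"
proof (induction m)
  case (Suc m)
  then show ?case using admissible_step[OF Suc] odds_eq_equilibrium[of "Suc (Suc m)"] by simp
qed (simp add: admissible_def)

lemma eq_odds_bounds: "2 \<le> m \<Longrightarrow> 0 < eq_odds m \<and> eq_odds m \<le> 1"
  using odds_eq_equilibrium[of m] by (simp add: odds_eq_def)

lemma exp_le_one_plus_double:
  assumes "0 \<le> x" "x \<le> 1"
  shows "exp x \<le> 1 + 2 * (x::real)"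
proof -
  have "exp x \<le> 1 + x + x^2" using assms by (rule exp_bound)
  also have "x^2 \<le> x" using assms by (simp add: power2_eq_square mult_left_le_one_le)
  finally show ?thesis by simp
qed

text \<open>\<open>E \<le> 4 * a * (v - b)\<close> together with \<open>a \<le> E\<close> gives an
  increase of at least 1/4 per player. This crude bound serves to reach 16 at \<open>m = 68\<close>,
  from where the sharper estimates apply.\<close>

lemma eq_latency_ge_linear: "4 \<le> m \<Longrightarrow> (real m - 4) / 4 \<le> eq_latency m"
proof (induction m rule: dec_induct)
  case base
  then show ?case using admissible_eq_latency[of 3] by (auto simp: admissible_def)
next
  case (step m)
  define t where "t = eq_odds (Suc m)"
  have m: "m - 1 = Suc (m - 2)" using step.hyps by simp
  have eq: "odds_eq m (eq_latency m) (eq_latency (m - 1)) t (eq_latency (Suc m))"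
    using odds_eq_equilibrium[of "Suc m"] step.hyps by (simp add: t_def numeral_2_eq_2)
  have inv: "admissible m (eq_latency m) (eq_latency (m - 1))" using admissible_eq_latency[of "m - 1"] step.hyps by simp
  have t: "0 < t" "t \<le> 1" using eq_odds_bounds[of "Suc m"] step.hyps by (auto simp: t_def)
  have "1 + real m * t \<le> (1 + t)^m" using t by (intro Bernoulli_inequality) auto
  then have "real m * t * 1 \<le> real m * t * (4 * (eq_latency (Suc m) - eq_latency m))"
    using odds_eq_growth(2)[OF inv _ eq] step.hyps by (simp add: mult_ac)
  moreover have "0 < real m * t" using t step.hyps by simp
  ultimately have "1 \<le> 4 * (eq_latency (Suc m) - eq_latency m)" by (simp only: mult_le_cancel_left_pos)
  then show ?case using step.IH by simp
qed

lemma eq_latency_growth: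
  assumes m: "4 \<le> m" and big: "16 \<le> eq_latency m"
  defines "l \<equiv> ln (eq_latency m)" and "a \<equiv> real m * eq_odds (Suc m)"
  shows "2 \<le> l" "l \<le> a" "a \<le> 4 * l"
    "l^2 + 1/16 \<le> (ln (eq_latency (Suc m)))^2" "(ln (eq_latency (Suc m)))^2 \<le> l^2 + 53"
    "eq_latency m \<le> eq_latency (Suc m)"
proof -
  define t b v E where "t = eq_odds (Suc m)" and "b = eq_latency m" and "v = eq_latency (Suc m)" and "E = (1 + t)^m"
  have eq: "odds_eq m b (eq_latency (m - 1)) t v"
    using odds_eq_equilibrium[of "Suc m"] m by (simp add: t_def b_def v_def numeral_2_eq_2)
  have inv: "admissible m b (eq_latency (m - 1))" using admissible_eq_latency[of "m - 1"] m by (simp add: b_def)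
  note g = odds_eq_growth[OF inv m eq, folded E_def]
  have t: "0 < t" "t \<le> 1" using eq_odds_bounds[of "Suc m"] m by (auto simp: t_def)
  have b16: "16 \<le> b" using big by (simp add: b_def)
  have l: "l = ln b" by (simp add: l_def b_def)
  have a: "a = real m * t" by (simp add: a_def t_def)
  have "exp 2 = exp 1 * exp (1::real)" by (simp flip: exp_add)
  also have "\<dots> \<le> 3 * 3" using exp_le by (intro mult_mono) auto
  finally have "exp 2 \<le> b" using b16 by simp
  then show l2: "2 \<le> l" using b16 by (simp add: l ln_ge_iff)
  have "b \<le> exp a" using g(3) power_le_exp[of t m] t by (simp add: E_def a)
  then have "ln b \<le> ln (exp a)" using b16 by (subst ln_le_cancel_iff) auto
  then show la: "l \<le> a" by (simp add: l)
  then have a2: "2 \<le> a" using l2 by simp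
  have E16: "E \<le> 16 * b" using g(5) a2 by (simp add: a)
  \<comment> \<open>Because \<open>t \<le> 1\<close>, the power \<open>(1 + t)^m\<close> is also at
    least \<open>exp (a / 2)\<close>; with \<open>16 \<le> b\<close> this yields
    \<open>exp (a / 2) \<le> b^2\<close>.\<close>
  have "exp (t / 2) \<le> 1 + 2 * (t / 2)" using t by (intro exp_le_one_plus_double) auto
  then have "exp (t / 2)^m \<le> E" unfolding E_def using t by (intro power_mono) auto
  then have "exp (a / 2) \<le> 16 * b" using E16 by (simp add: a flip: exp_of_nat_mult)
  then have "ln (exp (a / 2)) \<le> ln (16 * b)" using b16 by (subst ln_le_cancel_iff) auto
  then have "a / 2 \<le> ln 16 + ln b" using b16 by (simp add: ln_mult)
  moreover have "ln 16 \<le> ln b" using b16 by simp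
  ultimately show a4: "a \<le> 4 * l" by (simp add: l)
  have v: "b \<le> v" by (rule odds_eq_ge[OF inv eq])
  then show "eq_latency m \<le> eq_latency (Suc m)" by (simp add: b_def v_def)
  define d where "d = ln v - ln b"
  have d: "d = ln (v / b)" using b16 v by (simp add: d_def ln_div)
  have vb: "v / b = 1 + (v - b) / b" using b16 by (simp add: field_simps)
  have "(v - b) * (3/2 * a) \<le> 16 * b" using g(1) E16 by (simp add: a)
  \<comment> \<open>11 rounds up \<open>16 / (3/2)\<close>.\<close>
  then have "(v - b) / b \<le> 11 / a" using b16 a2 by (simp add: field_simps)
  also have "\<dots> \<le> 11 / l" using la l2 by (intro divide_left_mono) auto
  finally have up: "(v - b) / b \<le> 11 / l" .
  have d0: "0 \<le> d" using v b16 by (simp add: d_def)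
  have "d \<le> (v - b) / b" unfolding d vb using v b16 by (intro ln_add_one_self_le_self) auto
  then have dup: "d \<le> 11 / l" using up by simp
  have "b \<le> 4 * a * (v - b)" using g(2,3) by (simp add: a)
  also have "\<dots> \<le> 4 * (4 * l) * (v - b)" using a4 v by (intro mult_right_mono) auto
  finally have "1 / (16 * l) \<le> (v - b) / b" using b16 l2 by (simp add: field_simps)
  moreover have "exp (1 / (32 * l)) \<le> 1 + 2 * (1 / (32 * l))"
    using l2 by (intro exp_le_one_plus_double) (auto simp: field_simps)
  ultimately have "exp (1 / (32 * l)) \<le> v / b" unfolding vb by (simp add: field_simps)
  then have "ln (exp (1 / (32 * l))) \<le> ln (v / b)" using b16 v by (subst ln_le_cancel_iff) auto
  then have dlo: "1 / (32 * l) \<le> d" by (simp add: d)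
  \<comment> \<open>As \<open>l * d\<close> lies between 1/32 and 11 and
    \<open>d \<le> 11/2\<close>, the increment \<open>2 * l * d + d^2\<close> lies between 1/16 and
    \<open>22 + 121/4 < 53\<close>.\<close>
  have sq: "(ln v)^2 = l^2 + 2 * (l * d) + d^2"
    by (simp add: d_def l power2_eq_square algebra_simps)
  have "1 / 32 \<le> l * d" using mult_left_mono[OF dlo, of l] l2 by simp
  then show "l^2 + 1/16 \<le> (ln (eq_latency (Suc m)))^2" unfolding v_def[symmetric] sq
    using zero_le_power2[of d] by linarith
  have "l * d \<le> 11" using mult_left_mono[OF dup, of l] l2 by simp
  moreover have "d \<le> 11 / 2" using dup l2 divide_left_mono[of 2 l 11] by simp
  then have "d^2 \<le> (11/2)^2" using d0 by (intro power_mono) auto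
  ultimately show "(ln (eq_latency (Suc m)))^2 \<le> l^2 + 53"
    unfolding v_def[symmetric] sq by (simp add: power2_eq_square)
qed

lemma eq_latency_ge_16: "68 \<le> m \<Longrightarrow> 16 \<le> eq_latency m"
  using eq_latency_ge_linear[of m] by simp

lemma ln_eq_latency_squared_bounds:
  assumes "68 \<le> m"
  shows "(real m - 68) / 16 \<le> (ln (eq_latency m))^2"
    "(ln (eq_latency m))^2 \<le> (ln (eq_latency 68))^2 + 53 * (real m - 68)"
  using assms
proof (induction m rule: dec_induct)
  case (step m)
  {
    case 1
    then show ?case using step.IH eq_latency_growth(4)[OF _ eq_latency_ge_16[of m]] step.hyps by simp
  next
    case 2
    then show ?case using step.IH eq_latency_growth(5)[OF _ eq_latency_ge_16[of m]] step.hyps by simp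
  }
qed auto

lemma ln_eq_latency_bounds:
  obtains C where "C > 0" "\<And>m. 136 \<le> m \<Longrightarrow> sqrt (real m) / 6 \<le> ln (eq_latency m)"
    "\<And>m. 136 \<le> m \<Longrightarrow> ln (eq_latency m) \<le> C * sqrt (real m)"
proof
  define C2 where "C2 = (ln (eq_latency 68))^2 + 53"
  show "sqrt C2 > 0" by (simp add: C2_def add_nonneg_pos)
  fix m :: nat assume m: "136 \<le> m"
  have l0: "0 \<le> ln (eq_latency m)" using eq_latency_ge_16[of m] m by simp
  \<comment> \<open>From \<open>136 = 2 * 68\<close> on the shift costs at most half of
    \<open>m\<close>; 36 is a convenient square above 32.\<close>
  have "real m / 36 \<le> (real m - 68) / 16" using m by simp
  then have "(sqrt (real m) / 6)^2 \<le> (ln (eq_latency m))^2"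
    using ln_eq_latency_squared_bounds(1)[of m] m by (simp add: power_divide)
  then show "sqrt (real m) / 6 \<le> ln (eq_latency m)" using l0 by (rule power2_le_imp_le)
  have "(ln (eq_latency 68))^2 * 1 \<le> (ln (eq_latency 68))^2 * real m" using m by (intro mult_left_mono) auto
  then have "(ln (eq_latency m))^2 \<le> C2 * real m"
    using ln_eq_latency_squared_bounds(2)[of m] m by (simp add: C2_def algebra_simps)
  then show "ln (eq_latency m) \<le> sqrt C2 * sqrt (real m)"
    using l0 by (simp add: real_le_rsqrt flip: real_sqrt_mult)
qed

lemma ln_future_latency_bigtheta: "(\<lambda>m. ln (eq_latency m - 1)) \<in> \<Theta>(\<lambda>m. sqrt (real m))"
proof -
  obtain C where C: "C > 0" "\<And>m. 136 \<le> m \<Longrightarrow> sqrt (real m) / 6 \<le> ln (eq_latency m)"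
    "\<And>m. 136 \<le> m \<Longrightarrow> ln (eq_latency m) \<le> C * sqrt (real m)" by (rule ln_eq_latency_bounds) blast
  show ?thesis
  proof (rule bigthetaI'[of "1/12" C])
    show "\<forall>\<^sub>F m in at_top. 1/12 * norm (sqrt (real m)) \<le> norm (ln (eq_latency m - 1)) \<and>
        norm (ln (eq_latency m - 1)) \<le> C * norm (sqrt (real m))"
    proof (rule eventually_mono[OF eventually_ge_at_top[of 136]])
      fix m :: nat assume m: "136 \<le> m"
      have l: "16 \<le> eq_latency m" using eq_latency_ge_16 m by simp
      \<comment> \<open>The future latency omits the current slot; squaring makes up for it and
        costs only a factor 2 in the logarithm.\<close>
      have "eq_latency m \<le> (eq_latency m - 1)^2"
      proof -
        have "3 * eq_latency m \<le> eq_latency m * eq_latency m" using l by (intro mult_right_mono) auto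
        then show ?thesis by (simp add: power2_eq_square algebra_simps)
      qed
      then have "ln (eq_latency m) \<le> ln ((eq_latency m - 1)^2)" using l by (subst ln_le_cancel_iff) auto
      also have "\<dots> = 2 * ln (eq_latency m - 1)" using l by (simp add: ln_realpow)
      finally have "sqrt (real m) / 12 \<le> ln (eq_latency m - 1)" using C(2)[OF m] by simp
      moreover have "ln (eq_latency m - 1) \<le> ln (eq_latency m)" using l by (subst ln_le_cancel_iff) auto
      then have "ln (eq_latency m - 1) \<le> C * sqrt (real m)" using C(3)[OF m] by simp
      ultimately show "1/12 * norm (sqrt (real m)) \<le> norm (ln (eq_latency m - 1)) \<and>
        norm (ln (eq_latency m - 1)) \<le> C * norm (sqrt (real m))"
        using l by simp
    qed
  qed (use C in auto)
qed

lemma eq_odds_bigtheta: "(\<lambda>m. eq_odds m / (1 + eq_odds m)) \<in> \<Theta>(\<lambda>m. 1 / sqrt (real m))"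
proof -
  obtain C where C: "C > 0" "\<And>m. 136 \<le> m \<Longrightarrow> sqrt (real m) / 6 \<le> ln (eq_latency m)"
    "\<And>m. 136 \<le> m \<Longrightarrow> ln (eq_latency m) \<le> C * sqrt (real m)" by (rule ln_eq_latency_bounds) blast
  show ?thesis
  proof (rule bigthetaI'[of "1/12" "8 * C"])
    show "\<forall>\<^sub>F m in at_top. 1/12 * norm (1 / sqrt (real m)) \<le> norm (eq_odds m / (1 + eq_odds m)) \<and>
        norm (eq_odds m / (1 + eq_odds m)) \<le> 8 * C * norm (1 / sqrt (real m))"
    proof (rule eventually_mono[OF eventually_ge_at_top[of 137]])
      fix m :: nat assume m: "137 \<le> m"
      \<comment> \<open>\<open>eq_odds m\<close> belongs to \<open>m - 1\<close> opponents, so the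
        growth estimates are those at \<open>k\<close>, and \<open>sqrt k\<close> must be compared
        with \<open>sqrt m\<close>.\<close>
      define k where "k = m - 1"
      have k: "m = Suc k" "136 \<le> k" using m by (auto simp: k_def)
      define t where "t = eq_odds m"
      have t: "0 < t" "t \<le> 1" using eq_odds_bounds[of m] m by (auto simp: t_def)
      define s where "s = sqrt (real k)"
      have s: "0 < s" "s * s = real k" using k by (auto simp: s_def)
      have g: "ln (eq_latency k) \<le> real k * t" "real k * t \<le> 4 * ln (eq_latency k)"
        using eq_latency_growth(2,3)[OF _ eq_latency_ge_16[of k]] k by (auto simp: t_def)
      have "s / 6 \<le> s * s * t" using g(1) C(2)[of k] k by (simp add: s_def)
      then have lo: "1 / (6 * s) \<le> t" using s(1) by (simp add: field_simps)
      have "s * s * t \<le> 4 * (C * s)" using g(2) C(3)[of k] k by (simp add: s_def)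
      then have up: "t \<le> 4 * C / s" using s(1) by (simp add: field_simps)
      have "s \<le> sqrt (real m)" by (simp add: s_def k)
      then have "1 / sqrt (real m) \<le> 1 / s" using s(1) k by (intro divide_left_mono mult_pos_pos) auto
      then have "1/12 * (1 / sqrt (real m)) \<le> t / 2" using lo by simp
      also have "t / 2 \<le> t / (1 + t)" using t by (intro divide_left_mono) auto
      finally have 1: "1/12 * (1 / sqrt (real m)) \<le> t / (1 + t)" .
      have "sqrt (real m) \<le> sqrt (4 * real k)" using k by simp
      also have "\<dots> = 2 * s" by (simp add: s_def real_sqrt_mult)
      finally have "4 * C * sqrt (real m) \<le> 4 * C * (2 * s)" using C(1) by (intro mult_left_mono) auto
      then have "4 * C / s \<le> 8 * C * (1 / sqrt (real m))" using s(1) k by (simp add: field_simps)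
      moreover have "t / (1 + t) \<le> t" using t by (simp add: field_simps)
      ultimately have 2: "t / (1 + t) \<le> 8 * C * (1 / sqrt (real m))" using up by linarith
      show "1/12 * norm (1 / sqrt (real m)) \<le> norm (eq_odds m / (1 + eq_odds m)) \<and>
        norm (eq_odds m / (1 + eq_odds m)) \<le> 8 * C * norm (1 / sqrt (real m))"
        using 1 2 t by (simp add: t_def)
    qed
  qed (use C in auto)
qed

section \<open>The game\<close>

definition count_lt :: "nat \<Rightarrow> (nat \<Rightarrow> nat) \<Rightarrow> nat \<Rightarrow> nat" where
  "count_lt N f c = card {j. j < N \<and> f j = c}"

definition expect_counts :: "nat pmf \<Rightarrow> nat \<Rightarrow> (nat \<Rightarrow> nat \<Rightarrow> real) \<Rightarrow> real" where
  "expect_counts p N g = measure_pmf.expectation (Pi_pmf {..<N} 0 (\<lambda>_. p))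
     (\<lambda>f. g (count_lt N f 1) (count_lt N f 2))"

lemma count_lt_Suc: "count_lt (Suc N) (f(N := a)) c = count_lt N f c + (if a = c then 1 else 0)"
proof -
  have "{j. j < Suc N \<and> (f(N := a)) j = c} = {j. j < N \<and> f j = c} \<union> (if a = c then {N} else {})"
    by (auto simp: less_Suc_eq)
  then show ?thesis by (auto simp: count_lt_def card_insert_if)
qed

lemma finite_set_Pi_pmf_lt: "finite (set_pmf p) \<Longrightarrow> finite (set_pmf (Pi_pmf {..<N::nat} d (\<lambda>_. p)))"
  by (auto simp: set_Pi_pmf intro!: finite_PiE_dflt)

context
  fixes p :: "nat pmf"
  assumes supp: "set_pmf p \<subseteq> {0, 1, 2}"
begin

lemma finite_support: "finite (set_pmf p)"
  using supp finite_subset by blast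

lemma pmf_0: "pmf p 0 = 1 - pmf p 1 - pmf p 2"
proof -
  have "(\<Sum>a\<in>{0,1,2}. pmf p a) = 1"
    using supp by (intro sum_pmf_eq_1) auto
  then show ?thesis by simp
qed

lemma integrable_counts: "integrable (measure_pmf (Pi_pmf {..<N::nat} 0 (\<lambda>_. p))) (h :: _ \<Rightarrow> real)"
  by (intro integrable_measure_pmf_finite finite_set_Pi_pmf_lt finite_support)

lemma expect_counts_0: "expect_counts p 0 g = g 0 0"
  by (simp add: expect_counts_def count_lt_def)

lemma expect_counts_add: "expect_counts p N (\<lambda>i j. g i j + h i j) = expect_counts p N g + expect_counts p N h"
  unfolding expect_counts_def by (intro Bochner_Integration.integral_add integrable_counts)

lemma expect_counts_diff: "expect_counts p N (\<lambda>i j. g i j - h i j) = expect_counts p N g - expect_counts p N h"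
  unfolding expect_counts_def by (intro Bochner_Integration.integral_diff integrable_counts)

lemma expect_counts_cmult: "expect_counts p N (\<lambda>i j. k * g i j) = k * expect_counts p N g"
  unfolding expect_counts_def by simp

lemma expect_counts_const: "expect_counts p N (\<lambda>i j. k) = k"
  unfolding expect_counts_def by simp

text \<open>Conditioning on the action of the opponent with index \<open>N\<close>. The closed forms
  below follow by induction from this recursion, each using only itself and events that demand fewer
  transmissions.\<close>

lemma expect_counts_Suc: "expect_counts p (Suc N) g
   = pmf p 1 * expect_counts p N (\<lambda>i j. g (Suc i) j) + pmf p 2 * expect_counts p N (\<lambda>i j. g i (Suc j))
     + (1 - pmf p 1 - pmf p 2) * expect_counts p N g"
proof -
  let ?h = "\<lambda>f. g (count_lt (Suc N) f 1) (count_lt (Suc N) f 2)"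
  let ?Q = "Pi_pmf {..<N} 0 (\<lambda>_. p)"
  have "expect_counts p (Suc N) g = measure_pmf.expectation
     (p \<bind> (\<lambda>y. map_pmf (\<lambda>f. f(N := y)) ?Q)) ?h"
    unfolding expect_counts_def lessThan_Suc by (subst Pi_pmf_insert') (auto simp: map_pmf_def)
  also have "\<dots> = (\<Sum>a\<in>{0,1,2}. pmf p a *\<^sub>R measure_pmf.expectation (map_pmf (\<lambda>f. f(N := a)) ?Q) ?h)"
    using supp finite_support by (intro pmf_expectation_bind) (auto intro!: finite_imageI finite_set_Pi_pmf_lt)
  also have "\<dots> = pmf p 0 * expect_counts p N g + pmf p 1 * expect_counts p N (\<lambda>i j. g (Suc i) j) + pmf p 2 * expect_counts p N (\<lambda>i j. g i (Suc j))"
    by (simp add: count_lt_Suc expect_counts_def)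
  finally show ?thesis by (simp add: pmf_0)
qed

lemma expect_counts_none1: "expect_counts p N (\<lambda>i j. of_bool (i = 0)) = (1 - pmf p 1)^N"
proof (induction N)
  case (Suc N)
  then show ?case by (simp add: expect_counts_Suc expect_counts_const algebra_simps)
qed (simp add: expect_counts_0)

lemma expect_counts_none2: "expect_counts p N (\<lambda>i j. of_bool (j = 0)) = (1 - pmf p 2)^N"
proof (induction N)
  case (Suc N)
  then show ?case by (simp add: expect_counts_Suc expect_counts_const algebra_simps)
qed (simp add: expect_counts_0)

lemma expect_counts_none12: "expect_counts p N (\<lambda>i j. of_bool (i = 0 \<and> j = 0)) = (1 - pmf p 1 - pmf p 2)^N"
proof (induction N)
  case (Suc N)
  then show ?case by (simp add: expect_counts_Suc expect_counts_const)
qed (simp add: expect_counts_0)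

lemma expect_counts_one1: "expect_counts p N (\<lambda>i j. of_bool (i = 1)) = real N * pmf p 1 * (1 - pmf p 1)^(N-1)"
proof (induction N)
  case (Suc N)
  have "expect_counts p (Suc N) (\<lambda>i j. of_bool (i = 1)) = pmf p 1 * expect_counts p N (\<lambda>i j. of_bool (i = 0)) + pmf p 2 * expect_counts p N (\<lambda>i j. of_bool (i = 1))
      + (1 - pmf p 1 - pmf p 2) * expect_counts p N (\<lambda>i j. of_bool (i = 1))"
    by (simp add: expect_counts_Suc expect_counts_const)
  then show ?case unfolding Suc expect_counts_none1 by (cases N) (simp_all add: algebra_simps)
qed (simp add: expect_counts_0)

lemma expect_counts_one2: "expect_counts p N (\<lambda>i j. of_bool (j = 1)) = real N * pmf p 2 * (1 - pmf p 2)^(N-1)"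
proof (induction N)
  case (Suc N)
  have "expect_counts p (Suc N) (\<lambda>i j. of_bool (j = 1)) = pmf p 1 * expect_counts p N (\<lambda>i j. of_bool (j = 1)) + pmf p 2 * expect_counts p N (\<lambda>i j. of_bool (j = 0))
      + (1 - pmf p 1 - pmf p 2) * expect_counts p N (\<lambda>i j. of_bool (j = 1))"
    by (simp add: expect_counts_Suc expect_counts_const)
  then show ?case unfolding Suc expect_counts_none2 by (cases N) (simp_all add: algebra_simps)
qed (simp add: expect_counts_0)

lemma expect_counts_none1_one2: "expect_counts p N (\<lambda>i j. of_bool (i = 0 \<and> j = 1))
    = real N * pmf p 2 * (1 - pmf p 1 - pmf p 2)^(N-1)"
proof (induction N)
  case (Suc N)
  have "expect_counts p (Suc N) (\<lambda>i j. of_bool (i = 0 \<and> j = 1)) = pmf p 1 * 0 + pmf p 2 * expect_counts p N (\<lambda>i j. of_bool (i = 0 \<and> j = 0))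
      + (1 - pmf p 1 - pmf p 2) * expect_counts p N (\<lambda>i j. of_bool (i = 0 \<and> j = 1))"
    by (simp add: expect_counts_Suc expect_counts_const)
  then show ?case unfolding Suc expect_counts_none12 by (cases N) (simp_all add: algebra_simps)
qed (simp add: expect_counts_0)

lemma expect_counts_one1_none2: "expect_counts p N (\<lambda>i j. of_bool (i = 1 \<and> j = 0))
    = real N * pmf p 1 * (1 - pmf p 1 - pmf p 2)^(N-1)"
proof (induction N)
  case (Suc N)
  have "expect_counts p (Suc N) (\<lambda>i j. of_bool (i = 1 \<and> j = 0)) = pmf p 1 * expect_counts p N (\<lambda>i j. of_bool (i = 0 \<and> j = 0)) + pmf p 2 * 0
      + (1 - pmf p 1 - pmf p 2) * expect_counts p N (\<lambda>i j. of_bool (i = 1 \<and> j = 0))"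
    by (simp add: expect_counts_Suc expect_counts_const)
  then show ?case unfolding Suc expect_counts_none12 by (cases N) (simp_all add: algebra_simps)
qed (simp add: expect_counts_0)

lemma expect_counts_one1_one2: "expect_counts p N (\<lambda>i j. of_bool (i = 1 \<and> j = 1))
    = real N * (real N - 1) * pmf p 1 * pmf p 2 * (1 - pmf p 1 - pmf p 2)^(N-2)"
proof (induction N)
  case (Suc N)
  have "expect_counts p (Suc N) (\<lambda>i j. of_bool (i = 1 \<and> j = 1))
    = pmf p 1 * expect_counts p N (\<lambda>i j. of_bool (i = 0 \<and> j = 1)) + pmf p 2 * expect_counts p N (\<lambda>i j. of_bool (i = 1 \<and> j = 0))
      + (1 - pmf p 1 - pmf p 2) * expect_counts p N (\<lambda>i j. of_bool (i = 1 \<and> j = 1))"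
    by (simp add: expect_counts_Suc)
  then have step: "expect_counts p (Suc N) (\<lambda>i j. of_bool (i = 1 \<and> j = 1))
    = 2 * real N * pmf p 1 * pmf p 2 * (1 - pmf p 1 - pmf p 2)^(N-1)
      + (1 - pmf p 1 - pmf p 2) * (real N * (real N - 1) * pmf p 1 * pmf p 2 * (1 - pmf p 1 - pmf p 2)^(N-2))"
    unfolding Suc expect_counts_none1_one2 expect_counts_one1_none2 by simp
  consider "N = 0" | "N = 1" | k where "N = Suc (Suc k)" by (metis One_nat_def not0_implies_Suc)
  then show ?case
  proof cases
    case 3
    then show ?thesis unfolding step by (simp add: algebra_simps)
  next
    case 1
    then show ?thesis unfolding step by simp
  next
    case 2
    then show ?thesis unfolding step by simp
  qed
qed (simp add: expect_counts_0)

end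

section \<open>Continuation values in terms of channel counts\<close>

definition continuation :: "protocol \<Rightarrow> (nat \<Rightarrow> ennreal) \<Rightarrow> nat \<Rightarrow> nat \<Rightarrow> ennreal" where
  "continuation P W m a = (\<integral>\<^sup>+ f. (if dev_success m f a then 0 else W (next_pending m f a)) \<partial>measure_pmf (others P m))"

lemma chan_success_count: "chan_success m f a c \<longleftrightarrow> count_lt (m - 1) f c + (if a = c then 1 else 0) = 1"
  by (simp add: chan_success_def count_lt_def)

lemma count_lt_le: "count_lt N f 1 + count_lt N f 2 \<le> N"
proof -
  have "count_lt N f 1 + count_lt N f 2 = card ({j. j < N \<and> f j = 1} \<union> {j. j < N \<and> f j = 2})"
    unfolding count_lt_def by (intro card_Un_disjoint[symmetric]) auto
  also have "\<dots> \<le> card {..<N}" by (intro card_mono) auto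
  finally show ?thesis by simp
qed

lemma card_channels: "card {c \<in> {1, 2 :: nat}. Q c} = of_bool (Q 1) + of_bool (Q 2)"
proof -
  have "{c \<in> {1, 2 :: nat}. Q c} = (if Q 1 then {1} else {}) \<union> (if Q 2 then {2} else {})" by auto
  then show ?thesis by simp
qed

lemma next_pending_count:
  "next_pending m f 0 = m - (of_bool (count_lt (m - 1) f 1 = 1) + of_bool (count_lt (m - 1) f 2 = 1))"
  "next_pending m f 1 = m - (of_bool (count_lt (m - 1) f 1 = 0) + of_bool (count_lt (m - 1) f 2 = 1))"
  "next_pending m f 2 = m - (of_bool (count_lt (m - 1) f 1 = 1) + of_bool (count_lt (m - 1) f 2 = 0))"
  unfolding next_pending_def card_channels chan_success_count by simp_all

lemma dev_success_count:
  "\<not> dev_success m f 0"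
  "dev_success m f 1 \<longleftrightarrow> count_lt (m - 1) f 1 = 0"
  "dev_success m f 2 \<longleftrightarrow> count_lt (m - 1) f 2 = 0"
  by (simp_all add: dev_success_def chan_success_count)

lemma next_pending_range:
  assumes "m \<in> {1..n}" "a \<in> {0, 1, 2}" "\<not> dev_success m f a"
  shows "next_pending m f a \<in> {1..n}"
proof -
  \<comment> \<open>Two opponents alone on different channels require \<open>m \<ge> 3\<close>, so
    the truncated subtraction \<open>m - 2\<close> stays positive.\<close>
  have "count_lt (m - 1) f 1 + count_lt (m - 1) f 2 \<le> m - 1" by (rule count_lt_le)
  then show ?thesis using assms
    by (auto simp: next_pending_count[simplified] dev_success_count[simplified] of_bool_def split: if_splits)
qed

section \<open>Bellman inequalities for truncated and full latencies\<close>

lemma pend_sum_Suc: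
  "(\<Sum>s<Suc T. pend P S s h m) = 1 + (\<integral>\<^sup>+ a. \<integral>\<^sup>+ f. (if dev_success m f a then 0
      else (\<Sum>s<T. pend P S s ((m, a) # h) (next_pending m f a))) \<partial>measure_pmf (others P m) \<partial>measure_pmf (S h m))"
proof -
  have "(\<Sum>s<Suc T. pend P S s h m) = 1 + (\<Sum>s<T. pend P S (Suc s) h m)"
    by (subst sum.lessThan_Suc_shift) simp
  also have "(\<Sum>s<T. pend P S (Suc s) h m) = (\<integral>\<^sup>+ a. \<integral>\<^sup>+ f. (\<Sum>s<T. if dev_success m f a then 0
      else pend P S s ((m, a) # h) (next_pending m f a)) \<partial>measure_pmf (others P m) \<partial>measure_pmf (S h m))"
    by (simp add: nn_integral_sum)
  also have "(\<lambda>a f. (\<Sum>s<T. if dev_success m f a then 0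
      else pend P S s ((m, a) # h) (next_pending m f a))) =
     (\<lambda>a f. if dev_success m f a then 0 else (\<Sum>s<T. pend P S s ((m, a) # h) (next_pending m f a)))"
    by (intro ext) simp
  finally show ?thesis .
qed

lemma pend_sum_le:
  assumes "\<And>h m. m \<in> {1..n} \<Longrightarrow> set_pmf (S h m) \<subseteq> {0, 1, 2}"
    and super: "\<And>h m. m \<in> {1..n} \<Longrightarrow> 1 + (\<integral>\<^sup>+ a. continuation P W m a \<partial>measure_pmf (S h m)) \<le> W m"
    and "m \<in> {1..n}"
  shows "(\<Sum>s<T. pend P S s h m) \<le> W m"
  using assms(3)
proof (induction T arbitrary: h m)
  case (Suc T)
  have "(\<Sum>s<Suc T. pend P S s h m) \<le> 1 + (\<integral>\<^sup>+ a. continuation P W m a \<partial>measure_pmf (S h m))"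
    unfolding pend_sum_Suc continuation_def
  proof (intro add_left_mono nn_integral_mono_AE AE_pmfI)
    fix a f assume "a \<in> set_pmf (S h m)"
    then have "a \<in> {0, 1, 2}" using assms(1) Suc.prems by blast
    then show "(if dev_success m f a then 0 else \<Sum>s<T. pend P S s ((m, a) # h) (next_pending m f a))
       \<le> (if dev_success m f a then 0 else W (next_pending m f a))"
      using Suc.IH next_pending_range[OF Suc.prems] by auto
  qed
  then show ?case using super[OF Suc.prems] by (rule order_trans)
qed simp

lemma exp_latency_le:
  assumes "\<And>h m. m \<in> {1..n} \<Longrightarrow> set_pmf (S h m) \<subseteq> {0, 1, 2}"
    and "\<And>h m. m \<in> {1..n} \<Longrightarrow> 1 + (\<integral>\<^sup>+ a. continuation P W m a \<partial>measure_pmf (S h m)) \<le> W m"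
    and "m \<in> {1..n}"
  shows "exp_latency P S m \<le> W m"
  unfolding exp_latency_def suminf_eq_SUP using pend_sum_le[OF assms] by (intro SUP_least) auto

text \<open>A subsolution is played forward for \<open>T\<close> slots; whoever is still pending
  then is charged the uniform bound \<open>C\<close> in place of \<open>W\<close>.\<close>

lemma le_pend_sum:
  assumes "\<And>h m. m \<in> {1..n} \<Longrightarrow> set_pmf (S h m) \<subseteq> {0, 1, 2}"
    and sub: "\<And>m a. m \<in> {1..n} \<Longrightarrow> a \<in> {0, 1, 2} \<Longrightarrow> W m \<le> 1 + continuation P W m a"
    and bound: "\<And>m. m \<in> {1..n} \<Longrightarrow> W m \<le> C" and "m \<in> {1..n}"
  shows "W m \<le> (\<Sum>s<T. pend P S s h m) + C * pend P S T h m"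
  using assms(4)
proof (induction T arbitrary: h m)
  case 0
  then show ?case using bound by simp
next
  case (Suc T)
  let ?M = "measure_pmf (others P m)" and ?A = "measure_pmf (S h m)"
  let ?s = "\<lambda>a f. \<Sum>s<T. pend P S s ((m, a) # h) (next_pending m f a)"
  let ?p = "\<lambda>a f. pend P S T ((m, a) # h) (next_pending m f a)"
  have "W m = (\<integral>\<^sup>+ a. W m \<partial>?A)" by simp
  also have "\<dots> \<le> (\<integral>\<^sup>+ a. 1 + continuation P W m a \<partial>?A)"
    using assms(1)[OF Suc.prems] sub[OF Suc.prems]
    by (intro nn_integral_mono_AE AE_pmfI) auto
  also have "\<dots> = 1 + (\<integral>\<^sup>+ a. continuation P W m a \<partial>?A)" by (simp add: nn_integral_add)
  also have "(\<integral>\<^sup>+ a. continuation P W m a \<partial>?A) \<le> (\<integral>\<^sup>+ a. \<integral>\<^sup>+ f. (if dev_success m f a then 0 else ?s a f)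
      + C * (if dev_success m f a then 0 else ?p a f) \<partial>?M \<partial>?A)"
    unfolding continuation_def
  proof (intro nn_integral_mono_AE AE_pmfI)
    fix a f assume "a \<in> set_pmf (S h m)"
    then have "a \<in> {0, 1, 2}" using assms(1) Suc.prems by blast
    then show "(if dev_success m f a then 0 else W (next_pending m f a))
      \<le> (if dev_success m f a then 0 else ?s a f) + C * (if dev_success m f a then 0 else ?p a f)"
      using Suc.IH next_pending_range[OF Suc.prems] by auto
  qed
  also have "\<dots> = (\<integral>\<^sup>+ a. \<integral>\<^sup>+ f. (if dev_success m f a then 0 else ?s a f) \<partial>?M \<partial>?A) + C * pend P S (Suc T) h m"
    by (simp add: nn_integral_add nn_integral_cmult)
  finally show ?case unfolding pend_sum_Suc by (simp add: add.assoc add_left_mono)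
qed

lemma pend_le_1: "pend P S s h m \<le> 1"
proof (induction s arbitrary: h m)
  case (Suc s)
  have "pend P S (Suc s) h m \<le> (\<integral>\<^sup>+ a. \<integral>\<^sup>+ f. 1 \<partial>measure_pmf (others P m) \<partial>measure_pmf (S h m))"
    unfolding pend.simps using Suc by (intro nn_integral_mono) auto
  then show ?case by simp
qed simp

text \<open>The charge \<open>C\<close> times the probability of being pending after
  \<open>T\<close> slots has to vanish. If the latency is infinite there is nothing to show;
  otherwise these probabilities are summable and tend to 0.\<close>

lemma le_exp_latency:
  assumes S: "\<And>h m. m \<in> {1..n} \<Longrightarrow> set_pmf (S h m) \<subseteq> {0, 1, 2}"
    and sub: "\<And>m a. m \<in> {1..n} \<Longrightarrow> a \<in> {0, 1, 2} \<Longrightarrow> W m \<le> 1 + continuation P W m a"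
    and bound: "\<And>m. m \<in> {1..n} \<Longrightarrow> W m \<le> ennreal C" and C: "0 \<le> C" and m: "m \<in> {1..n}"
  shows "W m \<le> exp_latency P S m"
proof (cases "exp_latency P S m = \<top>")
  case False
  define g where "g s = enn2real (pend P S s [] m)" for s
  have g: "pend P S s [] m = ennreal (g s)" "0 \<le> g s" for s
  proof -
    have "pend P S s [] m < \<top>" using pend_le_1[of P S s "[]" m] by (rule le_less_trans) simp
    then show "pend P S s [] m = ennreal (g s)" by (simp add: g_def)
  qed (simp add: g_def)
  have "(\<Sum>s. ennreal (g s)) \<noteq> \<top>" using False unfolding exp_latency_def g .
  then have "summable g" using g(2) by (intro summable_suminf_not_top) auto
  then have "(\<lambda>T. C * g T) \<longlonglongrightarrow> C * 0" by (intro tendsto_mult_left summable_LIMSEQ_zero)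
  then have "(\<lambda>T. ennreal (C * g T)) \<longlonglongrightarrow> ennreal (C * 0)" by (rule tendsto_ennrealI)
  then have "(\<lambda>T. exp_latency P S m + ennreal (C * g T)) \<longlonglongrightarrow> exp_latency P S m + ennreal (C * 0)"
    by (intro tendsto_add tendsto_const)
  then have lim: "(\<lambda>T. exp_latency P S m + ennreal (C * g T)) \<longlonglongrightarrow> exp_latency P S m" by simp
  show ?thesis
  proof (rule LIMSEQ_le_const[OF lim], intro exI allI impI)
    fix T
    have "W m \<le> (\<Sum>s<T. pend P S s [] m) + ennreal C * pend P S T [] m"
      using S sub bound m by (rule le_pend_sum)
    also have "\<dots> \<le> exp_latency P S m + ennreal C * pend P S T [] m"
      unfolding exp_latency_def by (intro add_right_mono sum_le_suminf) auto
    also have "ennreal C * pend P S T [] m = ennreal (C * g T)"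
      unfolding g using C g(2) by (simp add: ennreal_mult)
    finally show "W m \<le> exp_latency P S m + ennreal (C * g T)" .
  qed
qed simp

lemma exp_latency_step:
  "(\<Sum>s. pend P S s h m) = 1 + (\<integral>\<^sup>+ a. \<integral>\<^sup>+ f. (if dev_success m f a then 0
      else (\<Sum>s. pend P S s ((m, a) # h) (next_pending m f a))) \<partial>measure_pmf (others P m) \<partial>measure_pmf (S h m))"
proof -
  have "(\<Sum>s. pend P S s h m) = (\<Sum>s. pend P S (Suc s) h m) + pend P S 0 h m"
    using suminf_offset[of "\<lambda>s. pend P S s h m" 1] by (simp add: add.commute)
  also have "(\<Sum>s. pend P S (Suc s) h m) = (\<integral>\<^sup>+ a. \<integral>\<^sup>+ f. (\<Sum>s. if dev_success m f a then 0
      else pend P S s ((m, a) # h) (next_pending m f a)) \<partial>measure_pmf (others P m) \<partial>measure_pmf (S h m))"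
    by (simp add: nn_integral_suminf)
  also have "(\<lambda>a f. (\<Sum>s. if dev_success m f a then 0
      else pend P S s ((m, a) # h) (next_pending m f a))) =
     (\<lambda>a f. if dev_success m f a then 0 else (\<Sum>s. pend P S s ((m, a) # h) (next_pending m f a)))"
    by (intro ext) simp
  finally show ?thesis by (simp add: add.commute)
qed

text \<open>The hypotheses cover both a protocol followed throughout and a deviation confined to the
  first slot: the latter is recognised by the empty history, and every later history is
  nonempty.\<close>

lemma pend_memoryless:
  assumes "\<And>h' m. h' \<noteq> [] \<Longrightarrow> S h' m = P' m" and "h = [] \<Longrightarrow> S = follow P'"
  shows "pend P S s h m = pend P (follow P') s [] m"
proof -
  have *: "pend P S s h m = pend P (follow P') s h' m" if "h \<noteq> []" for h h' m
    using that
  proof (induction s arbitrary: h h' m)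
    case (Suc s)
    have "pend P S s ((m, a) # h) k = pend P (follow P') s ((m, a) # h') k" for a k
      by (rule Suc.IH) simp
    then show ?case using assms(1)[OF Suc.prems] by (simp add: follow_def cong: if_cong)
  qed simp
  have **: "pend P (follow P') s h m = pend P (follow P') s h' m" for h h' m
  proof (induction s arbitrary: h h' m)
    case (Suc s)
    have "pend P (follow P') s ((m, a) # h) k = pend P (follow P') s ((m, a) # h') k" for a k
      by (rule Suc.IH)
    then show ?case by (simp add: follow_def cong: if_cong)
  qed simp
  show ?thesis using * ** assms(2) by (cases "h = []") auto
qed

lemma exp_latency_follow_step:
  "exp_latency P (follow P') m = 1 + (\<integral>\<^sup>+ a. continuation P (exp_latency P (follow P')) m a \<partial>measure_pmf (P' m))"
proof -
  have "pend P (follow P') s (x # h) k = pend P (follow P') s [] k" for s x h k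
    by (rule pend_memoryless) (auto simp: follow_def)
  then show ?thesis
    unfolding exp_latency_def continuation_def by (subst exp_latency_step) (simp add: follow_def cong: if_cong)
qed

lemma exp_latency_one_shot:
  "exp_latency P (\<lambda>h k. if h = [] then return_pmf a else P k) m
     = 1 + continuation P (exp_latency P (follow P)) m a"
proof -
  have "pend P (\<lambda>h k. if h = [] then return_pmf a else P k) s (x # h) k = pend P (follow P) s [] k" for s x h k
    by (rule pend_memoryless) auto
  then show ?thesis
    unfolding exp_latency_def continuation_def by (subst exp_latency_step) (simp add: nn_integral_return cong: if_cong)
qed

lemma pend_cong:
  assumes "\<And>h k. k \<in> {1..n} \<Longrightarrow> set_pmf (S h k) \<subseteq> {0, 1, 2}"
    and "\<And>h k. k \<in> {1..n} \<Longrightarrow> S' h k = S h k" and "m \<in> {1..n}"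
  shows "pend P S' s h m = pend P S s h m"
  using assms(3)
proof (induction s arbitrary: h m)
  case (Suc s)
  show ?case unfolding pend.simps assms(2)[OF Suc.prems]
  proof (intro nn_integral_cong_AE AE_pmfI)
    fix a f assume "a \<in> set_pmf (S h m)"
    then have "a \<in> {0, 1, 2}" using assms(1) Suc.prems by blast
    then show "(if dev_success m f a then 0 else pend P S' s ((m, a) # h) (next_pending m f a))
      = (if dev_success m f a then 0 else pend P S s ((m, a) # h) (next_pending m f a))"
      using Suc.IH next_pending_range[OF Suc.prems] by auto
  qed
qed simp

text \<open>\<open>valid_strategy\<close> constrains all pending counts, an equilibrium protocol
  only those up to \<open>n\<close>, so deviations assembled from \<open>P\<close> need not be
  valid. Making them silent elsewhere changes nothing, as play never leaves
  \<open>{1..n}\<close>.\<close>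

lemma equilibriumD:
  assumes eq: "equilibrium n P" and "\<And>h k. k \<in> {1..n} \<Longrightarrow> set_pmf (S h k) \<subseteq> {0, 1, 2}" "m \<in> {1..n}"
  shows "exp_latency P (follow P) m \<le> exp_latency P S m"
proof -
  define S' where "S' h k = (if k \<in> {1..n} then S h k else return_pmf 0)" for h k
  have "valid_strategy S'" unfolding valid_strategy_def S'_def using assms(2) by auto
  then have "exp_latency P (follow P) m \<le> exp_latency P S' m"
    using eq assms(3) by (auto simp: equilibrium_def)
  also have "\<dots> = exp_latency P S m"
    unfolding exp_latency_def using pend_cong[of n S S' m P] assms(2,3) by (simp add: S'_def)
  finally show ?thesis .
qed

section \<open>Equilibrium and the one-slot equations\<close>

context
  fixes P :: protocol and v :: "nat \<Rightarrow> real" and m :: nat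
  assumes supp: "set_pmf (P m) \<subseteq> {0, 1, 2}" and v0: "\<And>k. 0 \<le> v k"
begin

text \<open>Nonnegativity is returned along with the value because \<open>ennreal\<close> truncates
  negative reals, whereas the gains are later compared as reals.\<close>

lemma continuation_eq_expect_counts:
  assumes "\<And>f. (if dev_success m f a then 0 else v (next_pending m f a))
     = g (count_lt (m - 1) f 1) (count_lt (m - 1) f 2)"
  shows "continuation P (\<lambda>k. ennreal (v k)) m a = ennreal (expect_counts (P m) (m - 1) g) \<and> 0 \<le> expect_counts (P m) (m - 1) g"
proof -
  have "continuation P (\<lambda>k. ennreal (v k)) m a
    = (\<integral>\<^sup>+ f. ennreal (g (count_lt (m - 1) f 1) (count_lt (m - 1) f 2)) \<partial>measure_pmf (others P m))"
    unfolding continuation_def assms[symmetric] by (intro nn_integral_cong) auto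
  also have "\<dots> = ennreal (expect_counts (P m) (m - 1) g)"
    unfolding expect_counts_def others_def
  proof (rule nn_integral_eq_integral)
    show "integrable (measure_pmf (Pi_pmf {..<m - 1} 0 (\<lambda>_. P m)))
       (\<lambda>f. g (count_lt (m - 1) f 1) (count_lt (m - 1) f 2))"
      by (rule integrable_counts[OF supp])
    show "AE f in measure_pmf (Pi_pmf {..<m - 1} 0 (\<lambda>_. P m)).
       0 \<le> g (count_lt (m - 1) f 1) (count_lt (m - 1) f 2)"
      unfolding assms[symmetric] using v0 by (intro AE_pmfI) auto
  qed
  finally show ?thesis
    unfolding expect_counts_def assms[symmetric] using v0 by (auto intro!: Bochner_Integration.integral_nonneg)
qed

lemma continuation_silent: "continuation P (\<lambda>k. ennreal (v k)) m 0
    = ennreal (v m - gain_silent (m - 1) (pmf (P m) 1) (pmf (P m) 2) (v (m - 1)) (v (m - 2)) (v m)) \<and>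
    0 \<le> v m - gain_silent (m - 1) (pmf (P m) 1) (pmf (P m) 2) (v (m - 1)) (v (m - 2)) (v m)"
proof -
  \<comment> \<open>Inclusion and exclusion: subtracting the joint event twice leaves exactly one
    single-opponent channel, which leads to \<open>m - 1\<close>; the joint event leads to
    \<open>m - 2\<close>.\<close>
  let ?g = "(\<lambda>i j. v m - ((v m - v (m - 1)) * (of_bool (i = 1) + of_bool (j = 1) - 2 * of_bool (i = 1 \<and> j = 1))
        + (v m - v (m - 2)) * of_bool (i = 1 \<and> j = 1)))"
  have "continuation P (\<lambda>k. ennreal (v k)) m 0 = ennreal (expect_counts (P m) (m - 1) ?g) \<and> 0 \<le> expect_counts (P m) (m - 1) ?g"
    by (intro continuation_eq_expect_counts)
      (auto simp: next_pending_count[simplified] dev_success_count[simplified] of_bool_def numeral_2_eq_2)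
  then show ?thesis
    by (simp only: expect_counts_diff[OF supp] expect_counts_add[OF supp] expect_counts_cmult[OF supp] expect_counts_const[OF supp]
        expect_counts_one1[OF supp] expect_counts_one2[OF supp] expect_counts_one1_one2[OF supp] gain_silent_def prob_one_def prob_both_def)
qed

lemma continuation_transmit1: "continuation P (\<lambda>k. ennreal (v k)) m 1
    = ennreal (v m - gain_transmit (m - 1) (pmf (P m) 1) (pmf (P m) 2) (v (m - 1)) (v m)) \<and>
    0 \<le> v m - gain_transmit (m - 1) (pmf (P m) 1) (pmf (P m) 2) (v (m - 1)) (v m)"
proof -
  let ?g = "(\<lambda>i j. v m - (v m * of_bool (i = 0)
        + (v m - v (m - 1)) * (of_bool (j = 1) - of_bool (i = 0 \<and> j = 1))))"
  have "continuation P (\<lambda>k. ennreal (v k)) m 1 = ennreal (expect_counts (P m) (m - 1) ?g) \<and> 0 \<le> expect_counts (P m) (m - 1) ?g"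
    by (intro continuation_eq_expect_counts)
      (auto simp: next_pending_count[simplified] dev_success_count[simplified] of_bool_def)
  then show ?thesis
    by (simp only: expect_counts_diff[OF supp] expect_counts_add[OF supp] expect_counts_cmult[OF supp] expect_counts_const[OF supp]
        expect_counts_none1[OF supp] expect_counts_one2[OF supp] expect_counts_none1_one2[OF supp] gain_transmit_def prob_one_def)
qed

lemma continuation_transmit2: "continuation P (\<lambda>k. ennreal (v k)) m 2
    = ennreal (v m - gain_transmit (m - 1) (pmf (P m) 2) (pmf (P m) 1) (v (m - 1)) (v m)) \<and>
    0 \<le> v m - gain_transmit (m - 1) (pmf (P m) 2) (pmf (P m) 1) (v (m - 1)) (v m)"
proof -
  have r: "1 - pmf (P m) 2 - pmf (P m) 1 = 1 - pmf (P m) 1 - pmf (P m) 2" by simp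
  let ?g = "(\<lambda>i j. v m - (v m * of_bool (j = 0)
        + (v m - v (m - 1)) * (of_bool (i = 1) - of_bool (i = 1 \<and> j = 0))))"
  have "continuation P (\<lambda>k. ennreal (v k)) m 2 = ennreal (expect_counts (P m) (m - 1) ?g) \<and> 0 \<le> expect_counts (P m) (m - 1) ?g"
    by (intro continuation_eq_expect_counts)
      (auto simp: next_pending_count[simplified] dev_success_count[simplified] of_bool_def)
  then show ?thesis
    by (simp only: expect_counts_diff[OF supp] expect_counts_add[OF supp] expect_counts_cmult[OF supp] expect_counts_const[OF supp]
        expect_counts_none2[OF supp] expect_counts_one1[OF supp] expect_counts_one1_none2[OF supp] gain_transmit_def prob_one_def r)
qed

lemma nn_integral_012: "(\<integral>\<^sup>+ a. ennreal (h a) \<partial>measure_pmf (P m))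
    = ennreal (h 0 * pmf (P m) 0 + h 1 * pmf (P m) 1 + h 2 * pmf (P m) 2)"
  if "\<And>a. a \<in> {0, 1, 2} \<Longrightarrow> 0 \<le> h a"
proof -
  have "(\<integral>\<^sup>+ a. ennreal (h a) \<partial>measure_pmf (P m)) = (\<Sum>a\<in>{0,1,2}. ennreal (h a) * ennreal (pmf (P m) a))"
    using supp by (intro nn_integral_measure_pmf_support) auto
  also have "\<dots> = ennreal (h 0 * pmf (P m) 0 + (h 1 * pmf (P m) 1 + h 2 * pmf (P m) 2))"
    using that by (simp add: ennreal_mult[symmetric] ennreal_plus[symmetric] del: ennreal_plus)
  finally show ?thesis by (simp add: add.assoc)
qed

text \<open>Complementary slackness: if no gain exceeds 1, the average gain is 1 exactly when all
  the nonnegative terms \<open>(1 - g a) * pmf (P m) a\<close> vanish, that is, when every action in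
  the support has gain 1.\<close>

lemma one_slot_eq_iff_optimal:
  "one_slot_eq (m - 1) (v (m - 1)) (v (m - 2)) (pmf (P m) 1) (pmf (P m) 2) (v m) \<longleftrightarrow>
    (\<forall>a\<in>{0, 1, 2}. ennreal (v m) \<le> 1 + continuation P (\<lambda>k. ennreal (v k)) m a) \<and>
    ennreal (v m) = 1 + (\<integral>\<^sup>+ a. continuation P (\<lambda>k. ennreal (v k)) m a \<partial>measure_pmf (P m))"
  (is "?L \<longleftrightarrow> ?R")
proof -
  let ?x = "pmf (P m) 1" and ?y = "pmf (P m) 2" and ?z = "pmf (P m) 0"
  define g where "g a = (if a = 0 then gain_silent (m - 1) ?x ?y (v (m - 1)) (v (m - 2)) (v m)
     else if a = 1 then gain_transmit (m - 1) ?x ?y (v (m - 1)) (v m)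
     else gain_transmit (m - 1) ?y ?x (v (m - 1)) (v m))" for a :: nat
  have c: "continuation P (\<lambda>k. ennreal (v k)) m a = ennreal (v m - g a)" "0 \<le> v m - g a" if "a \<in> {0, 1, 2}" for a
    using that continuation_silent continuation_transmit1 continuation_transmit2 by (auto simp: g_def)
  have "(\<integral>\<^sup>+ a. continuation P (\<lambda>k. ennreal (v k)) m a \<partial>measure_pmf (P m)) = (\<integral>\<^sup>+ a. ennreal (v m - g a) \<partial>measure_pmf (P m))"
    using supp by (intro nn_integral_cong_AE AE_pmfI c) auto
  also have "\<dots> = ennreal ((v m - g 0) * ?z + (v m - g 1) * ?x + (v m - g 2) * ?y)"
    using c(2) by (rule nn_integral_012)
  also have "(v m - g 0) * ?z + (v m - g 1) * ?x + (v m - g 2) * ?y = v m - (g 0 * ?z + g 1 * ?x + g 2 * ?y)"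
    by (simp add: pmf_0[OF supp] algebra_simps)
  finally have int: "(\<integral>\<^sup>+ a. continuation P (\<lambda>k. ennreal (v k)) m a \<partial>measure_pmf (P m))
      = ennreal (v m - (g 0 * ?z + g 1 * ?x + g 2 * ?y))" .
  have int0: "0 \<le> v m - (g 0 * ?z + g 1 * ?x + g 2 * ?y)"
  proof -
    have "0 \<le> (v m - g 0) * ?z + (v m - g 1) * ?x + (v m - g 2) * ?y"
      using c(2)[of 0] c(2)[of 1] c(2)[of 2] by (intro add_nonneg_nonneg mult_nonneg_nonneg) auto
    then show ?thesis by (simp add: pmf_0[OF supp] algebra_simps)
  qed
  have plus: "1 + ennreal z = ennreal (1 + z)" if "0 \<le> z" for z
    using that by (simp flip: ennreal_1 ennreal_plus)
  have le: "ennreal (v m) \<le> 1 + continuation P (\<lambda>k. ennreal (v k)) m a \<longleftrightarrow> g a \<le> 1" if "a \<in> {0, 1, 2}" for a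
    unfolding c(1)[OF that] plus[OF c(2)[OF that]] using c(2)[OF that] by (subst ennreal_le_iff) auto
  have eq: "ennreal (v m) = 1 + (\<integral>\<^sup>+ a. continuation P (\<lambda>k. ennreal (v k)) m a \<partial>measure_pmf (P m))
      \<longleftrightarrow> g 0 * ?z + g 1 * ?x + g 2 * ?y = 1"
    unfolding int plus[OF int0] using v0[of m] int0 by (subst ennreal_inj) auto
  have z: "?z = 1 - ?x - ?y" by (rule pmf_0[OF supp])
  have z0: "0 \<le> ?z" "0 \<le> ?x" "0 \<le> ?y" by simp_all
  have g: "g 0 = gain_silent (m - 1) ?x ?y (v (m - 1)) (v (m - 2)) (v m)"
    "g 1 = gain_transmit (m - 1) ?x ?y (v (m - 1)) (v m)" "g 2 = gain_transmit (m - 1) ?y ?x (v (m - 1)) (v m)"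
    by (simp_all add: g_def)
  have R: "?R \<longleftrightarrow> g 0 \<le> 1 \<and> g 1 \<le> 1 \<and> g 2 \<le> 1 \<and> g 0 * ?z + g 1 * ?x + g 2 * ?y = 1"
    using le[of 0] le[of 1] le[of 2] eq by auto
  have L: "?L \<longleftrightarrow> g 0 \<le> 1 \<and> g 1 \<le> 1 \<and> g 2 \<le> 1 \<and> (0 < ?z \<longrightarrow> g 0 = 1) \<and> (0 < ?x \<longrightarrow> g 1 = 1) \<and> (0 < ?y \<longrightarrow> g 2 = 1)"
    unfolding one_slot_eq_def g[symmetric] using z z0 by auto
  have "g 0 * ?z + g 1 * ?x + g 2 * ?y = 1 \<longleftrightarrow> (1 - g 0) * ?z + (1 - g 1) * ?x + (1 - g 2) * ?y = 0"
    using z by (auto simp: algebra_simps)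
  also have "\<dots> \<longleftrightarrow> (0 < ?z \<longrightarrow> g 0 = 1) \<and> (0 < ?x \<longrightarrow> g 1 = 1) \<and> (0 < ?y \<longrightarrow> g 2 = 1)"
    if "g 0 \<le> 1 \<and> g 1 \<le> 1 \<and> g 2 \<le> 1"
  proof -
    have "(1 - g 0) * ?z + (1 - g 1) * ?x + (1 - g 2) * ?y = 0 \<longleftrightarrow>
      (1 - g 0) * ?z = 0 \<and> (1 - g 1) * ?x = 0 \<and> (1 - g 2) * ?y = 0"
      using that z0 by (simp add: add_nonneg_eq_0_iff)
    then show ?thesis using z0 by (auto simp: less_le)
  qed
  finally show ?thesis unfolding L R by blast
qed

end

text \<open>One of the two channels is used with probability at most 1/2. Insisting on it while
  \<open>m\<close> players are pending succeeds in each slot with probability at least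
  \<open>(1/2)^(m-1)\<close>, and the latencies for fewer players are finite by induction; an
  equilibrium cannot be worse than this deviation.\<close>

lemma equilibrium_latency_finite:
  assumes eq: "equilibrium n P"
  defines "V \<equiv> exp_latency P (follow P)"
  shows "m \<in> {1..n} \<Longrightarrow> V m < \<top>"
proof (induction m rule: less_induct)
  case (less m)
  have supp: "set_pmf (P k) \<subseteq> {0, 1, 2}" if "k \<in> {1..n}" for k
    using eq that by (auto simp: equilibrium_def)
  note pm = supp[OF less.prems]
  obtain a where a: "a \<in> {1, 2}" "pmf (P m) a \<le> 1/2"
  proof -
    have "pmf (P m) 1 \<le> 1/2 \<or> pmf (P m) 2 \<le> 1/2"
      using pmf_0[OF pm] pmf_nonneg[of "P m" 0] by linarith
    then show ?thesis using that[of 1] that[of 2] by auto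
  qed
  define \<rho> where "\<rho> = 1 - (1 - pmf (P m) a)^(m - 1)"
  have \<rho>: "\<rho> < 1" "0 \<le> \<rho>" using a by (auto simp: \<rho>_def power_le_one pmf_le_1)
  define B where "B = enn2real (\<Sum>k\<in>{1..<m}. V k)"
  have "(\<Sum>k\<in>{1..<m}. V k) < \<top>" using less by auto
  then have B: "ennreal B = (\<Sum>k\<in>{1..<m}. V k)" by (simp add: B_def)
  have VB: "V k \<le> ennreal B" if "k \<in> {1..<m}" for k
    unfolding B using that by (intro member_le_sum) auto
  have B0: "0 \<le> B" by (simp add: B_def)
  \<comment> \<open>The fixed point of \<open>K = 1 + \<rho> * K + B\<close>: \<open>\<rho>\<close>
    is the probability of failing on channel \<open>a\<close>, and \<open>B\<close> bounds every
    latency with fewer players.\<close>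
  define K where "K = (1 + B) / (1 - \<rho>)"
  have K: "0 \<le> K" "1 + (\<rho> * K + B) = K" using \<rho> B0 by (auto simp: K_def field_simps)
  define P' where "P' = P(m := return_pmf a)"
  define W where "W k = (if k = m then ennreal K else V k)" for k
  have cont: "continuation P W m a \<le> ennreal (\<rho> * K + B)"
  proof -
    have "continuation P W m a \<le> (\<integral>\<^sup>+ f. ennreal (K * of_bool (count_lt (m - 1) f a \<noteq> 0) + B) \<partial>measure_pmf (others P m))"
      unfolding continuation_def
    proof (intro nn_integral_mono)
      fix f
      show "(if dev_success m f a then 0 else W (next_pending m f a))
        \<le> ennreal (K * of_bool (count_lt (m - 1) f a \<noteq> 0) + B)"
      proof (cases "dev_success m f a")
        case False
        then have c: "count_lt (m - 1) f a \<noteq> 0" using a by (auto simp: dev_success_count[simplified])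
        have n: "next_pending m f a \<in> {1..m}"
          using next_pending_range[of m m a f] False a less.prems by auto
        show ?thesis
        proof (cases "next_pending m f a = m")
          case True
          then show ?thesis using False c B0 by (auto simp: W_def intro!: ennreal_leI)
        next
          case neq: False
          then have "V (next_pending m f a) \<le> ennreal B" using n by (intro VB) auto
          also have "\<dots> \<le> ennreal (K + B)" using K by (intro ennreal_leI) auto
          finally show ?thesis using False c neq by (simp add: W_def)
        qed
      qed simp
    qed
    also have "\<dots> = ennreal (measure_pmf.expectation (others P m) (\<lambda>f. K * of_bool (count_lt (m - 1) f a \<noteq> 0) + B))"
      unfolding others_def using K B0 by (intro nn_integral_eq_integral integrable_counts[OF pm] AE_pmfI) auto
    also have "measure_pmf.expectation (others P m) (\<lambda>f. K * of_bool (count_lt (m - 1) f a \<noteq> 0) + B)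
        = expect_counts (P m) (m - 1) (\<lambda>i j. K * (1 - (if a = 1 then of_bool (i = 0) else of_bool (j = 0))) + B)"
      unfolding expect_counts_def others_def using a by (intro Bochner_Integration.integral_cong) auto
    also have "\<dots> = \<rho> * K + B"
      using a by (auto simp: expect_counts_add[OF pm] expect_counts_cmult[OF pm] expect_counts_diff[OF pm] expect_counts_const[OF pm]
          expect_counts_none1[OF pm, simplified] expect_counts_none2[OF pm] \<rho>_def)
    finally show ?thesis .
  qed
  have "V m \<le> exp_latency P (follow P') m"
    unfolding V_def using a supp by (intro equilibriumD[OF eq] less.prems) (auto simp: follow_def P'_def)
  also have "\<dots> \<le> W m"
  proof (rule exp_latency_le[of m])
    show "set_pmf (follow P' h k) \<subseteq> {0, 1, 2}" if "k \<in> {1..m}" for h k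
      using that a supp[of k] less.prems by (auto simp: follow_def P'_def)
    show "1 + (\<integral>\<^sup>+ a. continuation P W k a \<partial>measure_pmf (follow P' h k)) \<le> W k" if k: "k \<in> {1..m}" for h k
    proof (cases "k = m")
      case True
      have "1 + ennreal (\<rho> * K + B) = ennreal (1 + (\<rho> * K + B))"
        using \<rho> K B0 by (simp flip: ennreal_1 ennreal_plus)
      then have "1 + continuation P W m a \<le> ennreal K" using add_left_mono[OF cont, of 1] unfolding K(2) by simp
      then show ?thesis using True by (simp add: follow_def P'_def W_def nn_integral_return)
    next
      case False
      \<comment> \<open>Below \<open>m\<close> the modified protocol is \<open>P\<close> itself and
        play cannot return to \<open>m\<close>, so there the supersolution is the Bellman equation
        of \<open>V\<close>.\<close>
      have "next_pending k f b \<noteq> m" for f b using k False by (auto simp: next_pending_def)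
      then have "continuation P W k b = continuation P V k b" for b by (simp add: continuation_def W_def cong: if_cong)
      then have "1 + (\<integral>\<^sup>+ a. continuation P W k a \<partial>measure_pmf (follow P' h k)) = V k"
        using exp_latency_follow_step[of P P k] False by (simp add: follow_def P'_def V_def)
      then show ?thesis using False by (simp add: W_def)
    qed
  qed (use less.prems in auto)
  also have "\<dots> < \<top>" by (simp add: W_def)
  finally show ?case .
qed

lemma equilibrium_imp_one_slot_eq:
  assumes eq: "equilibrium n P"
  obtains v where "v 0 = 0" "\<And>m. m \<in> {1..n} \<Longrightarrow> exp_latency P (follow P) m = ennreal (v m)"
    "\<And>m. m \<in> {1..n} \<Longrightarrow> 1 \<le> v m"
    "\<And>m. m \<in> {1..n} \<Longrightarrow> one_slot_eq (m - 1) (v (m - 1)) (v (m - 2)) (pmf (P m) 1) (pmf (P m) 2) (v m)"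
proof -
  define V where "V = exp_latency P (follow P)"
  \<comment> \<open>The value 0 at \<open>k = 0\<close> agrees with \<open>eq_latency 0\<close>,
    which is the \<open>c\<close> of the step to two players.\<close>
  define v where "v k = (if k \<in> {1..n} then enn2real (V k) else 0)" for k
  have supp: "set_pmf (P k) \<subseteq> {0, 1, 2}" if "k \<in> {1..n}" for k
    using eq that by (auto simp: equilibrium_def)
  have v0: "0 \<le> v k" for k by (simp add: v_def)
  have V: "V k = ennreal (v k)" if "k \<in> {1..n}" for k
    using equilibrium_latency_finite[OF eq that] that by (simp add: v_def V_def)
  have cont: "continuation P (\<lambda>k. ennreal (v k)) m a = continuation P V m a" if "m \<in> {1..n}" "a \<in> {0, 1, 2}" for m a
    unfolding continuation_def using V next_pending_range[OF that] by (intro nn_integral_cong) auto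
  have step: "V m = 1 + (\<integral>\<^sup>+ a. continuation P V m a \<partial>measure_pmf (P m))" for m
    unfolding V_def by (rule exp_latency_follow_step)
  show ?thesis
  proof (rule that)
    fix m assume m: "m \<in> {1..n}"
    show "exp_latency P (follow P) m = ennreal (v m)" using V[OF m] by (simp add: V_def)
    have "1 \<le> ennreal (v m)" unfolding V[OF m, symmetric] by (subst step) simp
    then show "1 \<le> v m" by simp
    have "V m \<le> 1 + continuation P V m a" if "a \<in> {0, 1, 2}" for a
      unfolding V_def exp_latency_one_shot[symmetric] using supp that
      by (intro equilibriumD[OF eq _ m]) auto
    moreover have "(\<integral>\<^sup>+ a. continuation P (\<lambda>k. ennreal (v k)) m a \<partial>measure_pmf (P m)) = (\<integral>\<^sup>+ a. continuation P V m a \<partial>measure_pmf (P m))"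
      using supp[OF m] by (intro nn_integral_cong_AE AE_pmfI cont[OF m]) auto
    ultimately show "one_slot_eq (m - 1) (v (m - 1)) (v (m - 2)) (pmf (P m) 1) (pmf (P m) 2) (v m)"
      unfolding one_slot_eq_iff_optimal[of P m v, OF supp[OF m] v0] using step[of m] V[OF m] cont[OF m] by simp
  qed (simp add: v_def)
qed

section \<open>Uniqueness and existence of the equilibrium\<close>

lemma eq_latency_nonneg: "0 \<le> eq_latency m"
  using admissible_eq_latency[of "m"] by (simp add: admissible_def)

lemma equilibrium_unique:
  assumes "equilibrium n P" "m \<in> {1..n}"
  shows "exp_latency P (follow P) m = ennreal (eq_latency m)"
    "2 \<le> m \<Longrightarrow> pmf (P m) 1 = eq_odds m / (1 + eq_odds m)"
    "2 \<le> m \<Longrightarrow> pmf (P m) 2 = eq_odds m / (1 + eq_odds m)"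
proof -
  obtain v where v: "v 0 = 0" "\<And>m. m \<in> {1..n} \<Longrightarrow> exp_latency P (follow P) m = ennreal (v m)"
    "\<And>m. m \<in> {1..n} \<Longrightarrow> 1 \<le> v m"
    "\<And>m. m \<in> {1..n} \<Longrightarrow> one_slot_eq (m - 1) (v (m - 1)) (v (m - 2)) (pmf (P m) 1) (pmf (P m) 2) (v m)"
    using equilibrium_imp_one_slot_eq[OF assms(1)] by metis
  have step: "v m = eq_latency m \<and> pmf (P m) 1 = eq_odds m / (1 + eq_odds m) \<and> pmf (P m) 2 = eq_odds m / (1 + eq_odds m)"
    if m: "m \<in> {1..n}" "2 \<le> m" and "v (m - 1) = eq_latency (m - 1)" "v (m - 2) = eq_latency (m - 2)" for m
  proof -
    have inv: "admissible (m - 1) (eq_latency (m - 1)) (eq_latency (m - 2))"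
    proof -
      have "m - 1 = Suc (m - 2)" using m by simp
      then show ?thesis using admissible_eq_latency[of "m - 2"] by simp
    qed
    have "one_slot_eq (m - 1) (eq_latency (m - 1)) (eq_latency (m - 2)) (pmf (P m) 1) (pmf (P m) 2) (v m)"
      using v(4)[OF m(1)] that(3,4) by simp
    then obtain t where t: "pmf (P m) 1 = t / (1 + t)" "pmf (P m) 2 = t / (1 + t)"
      "odds_eq (m - 1) (eq_latency (m - 1)) (eq_latency (m - 2)) t (v m)"
      using one_slot_eq_imp_symmetric[OF inv] by blast
    then show ?thesis using odds_eq_unique[OF inv t(3) odds_eq_equilibrium[OF m(2)]] by simp
  qed
  have eq_latency: "m \<in> {1..n} \<Longrightarrow> v m = eq_latency m" for m
  proof (induction m rule: less_induct)
    case (less m)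
    show ?case
    proof (cases "m = 1")
      case True
      \<comment> \<open>Without opponents the gain of a transmission is \<open>v\<close> itself, so
        \<open>v 1 \<le> 1\<close>; the reverse holds because the current slot counts.\<close>
      then show ?thesis using v(3,4)[OF less.prems] by (simp add: one_slot_eq_def gain_transmit_def prob_one_def)
    next
      case False
      then have "v (m - 1) = eq_latency (m - 1)" using less by auto
      moreover have "v (m - 2) = eq_latency (m - 2)"
        using less v(1) by (cases "m - 2 = 0") auto
      ultimately show ?thesis using step[OF less.prems] False less.prems by auto
    qed
  qed
  show "exp_latency P (follow P) m = ennreal (eq_latency m)" using v(2) eq_latency assms(2) by simp
  assume m2: "2 \<le> m"
  have "m - 1 \<in> {1..n}" "m - 2 = 0 \<or> m - 2 \<in> {1..n}" using assms(2) m2 by auto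
  then have "v (m - 1) = eq_latency (m - 1)" "v (m - 2) = eq_latency (m - 2)" using eq_latency v(1) by auto
  then show "pmf (P m) 1 = eq_odds m / (1 + eq_odds m)" "pmf (P m) 2 = eq_odds m / (1 + eq_odds m)"
    using step[OF assms(2) m2] by auto
qed

definition sym_pmf :: "real \<Rightarrow> nat pmf" where
  "sym_pmf p = bind_pmf (bernoulli_pmf (2 * p)) (\<lambda>b. if b
     then map_pmf (\<lambda>c. if c then 1 else 2) (bernoulli_pmf (1/2)) else return_pmf 0)"

lemma set_sym_pmf: "set_pmf (sym_pmf p) \<subseteq> {0, 1, 2}"
  by (auto simp: sym_pmf_def split: if_splits)

lemma pmf_sym_pmf:
  assumes "0 \<le> p" "p \<le> 1/2"
  shows "pmf (sym_pmf p) 1 = p" "pmf (sym_pmf p) 2 = p"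
  using assms by (simp_all add: sym_pmf_def map_pmf_def pmf_bind integral_bernoulli_pmf)

lemma equilibrium_exists: "\<exists>P. equilibrium n P"
proof
  \<comment> \<open>A lone player must transmit, but any division between the channels is optimal;
    1/2 rules out silence and keeps the symmetric form.\<close>
  define p where "p m = (if 2 \<le> m then eq_odds m / (1 + eq_odds m) else 1/2)" for m
  define P where "P m = sym_pmf (p m)" for m
  have p: "0 \<le> p m" "p m \<le> 1/2" for m
    using eq_odds_bounds[of m] by (auto simp: p_def field_simps)
  have pmf: "pmf (P m) 1 = p m" "pmf (P m) 2 = p m" for m
    using p pmf_sym_pmf by (simp_all only: P_def)
  have supp: "set_pmf (P m) \<subseteq> {0, 1, 2}" for m unfolding P_def by (rule set_sym_pmf)
  let ?W = "\<lambda>k. ennreal (eq_latency k)"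
  have eq: "one_slot_eq (m - 1) (eq_latency (m - 1)) (eq_latency (m - 2)) (pmf (P m) 1) (pmf (P m) 2) (eq_latency m)" if "1 \<le> m" for m
  proof (cases "m = 1")
    case True
    then show ?thesis unfolding pmf by (simp add: p_def one_slot_eq_def gain_transmit_def gain_silent_def prob_one_def prob_both_def)
  next
    case False
    then have m: "2 \<le> m" using that by simp
    have "one_slot_eq (m - 1) (eq_latency (m - 1)) (eq_latency (m - 2)) (eq_odds m / (1 + eq_odds m)) (eq_odds m / (1 + eq_odds m)) (eq_latency m)"
      using odds_eq_equilibrium[OF m] eq_odds_bounds[OF m] m by (subst one_slot_eq_iff_odds_eq) auto
    then show ?thesis unfolding pmf using m by (simp add: p_def)
  qed
  have opt: "\<And>a. a \<in> {0, 1, 2} \<Longrightarrow> ?W m \<le> 1 + continuation P ?W m a"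
    "?W m = 1 + (\<integral>\<^sup>+ a. continuation P ?W m a \<partial>measure_pmf (P m))" if "m \<in> {1..n}" for m
    using eq[of m] that one_slot_eq_iff_optimal[of P m eq_latency, OF supp eq_latency_nonneg] by auto
  \<comment> \<open>The same function is a supersolution along \<open>P\<close> and a subsolution
    for every action, hence a lower bound for every history-dependent strategy.\<close>
  have le: "exp_latency P (follow P) m \<le> ?W m" if "m \<in> {1..n}" for m
    using that supp opt(2) by (intro exp_latency_le[of n]) (auto simp: follow_def)
  have ge: "?W m \<le> exp_latency P S m" if "m \<in> {1..n}" "valid_strategy S" for m S
  proof (rule le_exp_latency[of n S ?W P "\<Sum>k\<in>{1..n}. eq_latency k"])
    show "ennreal (eq_latency k) \<le> ennreal (\<Sum>k\<in>{1..n}. eq_latency k)" if "k \<in> {1..n}" for k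
      using that eq_latency_nonneg by (intro ennreal_leI member_le_sum) auto
    show "0 \<le> (\<Sum>k\<in>{1..n}. eq_latency k)" using eq_latency_nonneg by (intro sum_nonneg) auto
  qed (use that opt(1) in \<open>auto simp: valid_strategy_def\<close>)
  show "equilibrium n P"
    unfolding equilibrium_def using supp le ge order_trans by blast
qed

theorem theorem6:
  shows "\<exists>(p :: nat \<Rightarrow> real) (L :: nat \<Rightarrow> real).
     p \<in> \<Theta>(\<lambda>m. 1 / sqrt (real m)) \<and>
     (\<lambda>m. ln (L m)) \<in> \<Theta>(\<lambda>m. sqrt (real m)) \<and>
     (\<forall>n :: nat.
        (\<exists>P. equilibrium n P) \<and>
        (\<forall>P. equilibrium n P \<longrightarrow>
           (\<forall>m \<in> {2..n}. pmf (P m) 1 = p m \<and> pmf (P m) 2 = p m \<and>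
                          future_latency P m = ennreal (L m))))"
proof (intro exI conjI allI impI ballI)
  show "(\<lambda>m. eq_odds m / (1 + eq_odds m)) \<in> \<Theta>(\<lambda>m. 1 / sqrt (real m))" by (rule eq_odds_bigtheta)
  show "(\<lambda>m. ln (eq_latency m - 1)) \<in> \<Theta>(\<lambda>m. sqrt (real m))" by (rule ln_future_latency_bigtheta)
  fix n
  show "equilibrium n (SOME P. equilibrium n P)" using equilibrium_exists by (rule someI_ex)
  fix P m assume eq: "equilibrium n P" and m: "m \<in> {2..n}"
  then have m': "m \<in> {1..n}" "2 \<le> m" by auto
  show "pmf (P m) 1 = eq_odds m / (1 + eq_odds m)" "pmf (P m) 2 = eq_odds m / (1 + eq_odds m)"
    using equilibrium_unique(2,3)[OF eq m'(1)] m'(2) by auto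
  show "future_latency P m = ennreal (eq_latency m - 1)"
    unfolding future_latency_def equilibrium_unique(1)[OF eq m'(1)]
    by (simp add: ennreal_minus flip: ennreal_1)
qed

end
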